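(* Let $G$ be a (simple, finite) bipartite graph with maximum degree at most $3$ such that $d(u)+d(v)\le 5$ for every edge $uv$ of $G$. Then $\chi_s'(G) \le 6$.
   Context: $d(u)$ denotes the degree of vertex $u$. A strong edge coloring of a graph $G$ is a proper edge coloring in which each color class is an induced matching of $G$; equivalently, any two distinct edges at distance at most two (i.e., edges that share a vertex or are joined by an edge) receive distinct colors. The strong chromatic index $\chi_s'(G)$ is the minimum number of colors in a strong edge coloring of $G$. *)

theory Defs
  imports Main
begin

text \<open>A graph is given by a vertex set \<open>V\<close> and a set \<open>E\<close> of edges, each edge being a two-element
  set of vertices; loops and multiple edges are thereby excluded.\<close>

definition finite_simple_graph :: "'a set \<Rightarrow> 'a set set \<Rightarrow> bool" where
  "finite_simple_graph V E \<longleftrightarrow> finite V \<and> (\<forall>e\<in>E. e \<subseteq> V \<and> card e = 2)"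

definition bipartite :: "'a set \<Rightarrow> 'a set set \<Rightarrow> bool" where
  "bipartite V E \<longleftrightarrow> (\<exists>A B. A \<union> B = V \<and> A \<inter> B = {} \<and> (\<forall>e\<in>E. \<exists>a\<in>A. \<exists>b\<in>B. e = {a, b}))"

definition degree :: "'a set set \<Rightarrow> 'a \<Rightarrow> nat" where
  "degree E v = card {e \<in> E. v \<in> e}"

text \<open>Inserting 0 gives the graph without vertices maximum degree 0, and changes nothing otherwise.\<close>

definition max_degree :: "'a set \<Rightarrow> 'a set set \<Rightarrow> nat" where
  "max_degree V E = Max (insert 0 (degree E ` V))"

definition proper_edge_coloring :: "'a set set \<Rightarrow> ('a set \<Rightarrow> 'c) \<Rightarrow> bool" where
  "proper_edge_coloring E c \<longleftrightarrow> (\<forall>e\<in>E. \<forall>f\<in>E. e \<noteq> f \<and> e \<inter> f \<noteq> {} \<longrightarrow> c e \<noteq> c f)"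

definition matching :: "'a set set \<Rightarrow> 'a set set \<Rightarrow> bool" where
  "matching E M \<longleftrightarrow> M \<subseteq> E \<and> (\<forall>e\<in>M. \<forall>f\<in>M. e \<noteq> f \<longrightarrow> e \<inter> f = {})"

text \<open>The second conjunct says that \<open>M\<close> is the whole edge set of the subgraph induced by the
  vertices that \<open>M\<close> covers.\<close>

definition induced_matching :: "'a set set \<Rightarrow> 'a set set \<Rightarrow> bool" where
  "induced_matching E M \<longleftrightarrow> matching E M \<and> {e \<in> E. e \<subseteq> \<Union>M} = M"

definition strong_edge_coloring :: "'a set set \<Rightarrow> ('a set \<Rightarrow> 'c) \<Rightarrow> bool" where
  "strong_edge_coloring E c \<longleftrightarrow>
     proper_edge_coloring E c \<and> (\<forall>i\<in>c ` E. induced_matching E {e \<in> E. c e = i})"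

definition strong_chromatic_index :: "'a set set \<Rightarrow> nat" where
  "strong_chromatic_index E =
     (LEAST k. \<exists>c :: 'a set \<Rightarrow> nat. strong_edge_coloring E c \<and> card (c ` E) = k)"

text \<open>Agreement with the description by distance: distinct edges that share a vertex or are joined
  by an edge receive distinct colors.\<close>

lemma strong_edge_coloring_iff_distance:
  assumes "finite_simple_graph V E"
  shows "strong_edge_coloring E c \<longleftrightarrow>
    (\<forall>e\<in>E. \<forall>f\<in>E. e \<noteq> f \<and> (e \<inter> f \<noteq> {} \<or> (\<exists>x\<in>e. \<exists>y\<in>f. {x, y} \<in> E)) \<longrightarrow> c e \<noteq> c f)"
    (is "_ \<longleftrightarrow> ?D")
proof
  assume s: "strong_edge_coloring E c"
  show ?D
  proof (intro ballI impI notI)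
    fix e f
    assume ef: "e \<in> E" "f \<in> E"
      and d: "e \<noteq> f \<and> (e \<inter> f \<noteq> {} \<or> (\<exists>x\<in>e. \<exists>y\<in>f. {x, y} \<in> E))"
      and eq: "c e = c f"
    let ?M = "{g \<in> E. c g = c e}"
    have "induced_matching E ?M"
      using s ef(1) unfolding strong_edge_coloring_def by blast
    then have ind: "{g \<in> E. g \<subseteq> \<Union>?M} = ?M" and mat: "matching E ?M"
      by (simp_all only: induced_matching_def)
    have disj: "g \<inter> h = {}" if "g \<in> ?M" "h \<in> ?M" "g \<noteq> h" for g h
      using mat that unfolding matching_def by blast
    have eM: "e \<in> ?M" and fM: "f \<in> ?M"
      using ef eq by auto
    have "e \<inter> f = {}"
      using disj[OF eM fM] d by blast
    then obtain x y where xy: "x \<in> e" "y \<in> f" "{x, y} \<in> E"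
      using d by blast
    have "{x, y} \<subseteq> \<Union>?M"
      using xy eM fM by blast
    then have "{x, y} \<in> {g \<in> E. g \<subseteq> \<Union>?M}"
      using xy(3) by simp
    then have gM: "{x, y} \<in> ?M"
      unfolding ind .
    have "{x, y} = e"
      using disj[OF gM eM] xy by blast
    moreover have "{x, y} = f"
      using disj[OF gM fM] xy by blast
    ultimately show False
      using d by blast
  qed
next
  assume D: ?D
  have "induced_matching E {e \<in> E. c e = i}" for i
  proof -
    have "g \<in> {e \<in> E. c e = i}" if g: "g \<in> E" "g \<subseteq> \<Union>{e \<in> E. c e = i}" for g
    proof -
      obtain x y where xy: "g = {x, y}" "x \<noteq> y"
        using assms g unfolding finite_simple_graph_def card_2_iff by metis
      from xy g(2) have "x \<in> \<Union>{e \<in> E. c e = i}" and "y \<in> \<Union>{e \<in> E. c e = i}"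
        by simp_all
      then obtain e f where ef: "e \<in> E" "c e = i" "x \<in> e" "f \<in> E" "c f = i" "y \<in> f"
        by blast
      have "\<exists>x\<in>e. \<exists>y\<in>f. {x, y} \<in> E"
        using ef(3,6) g(1) xy(1) by blast
      then have "e = f"
        using D ef(1,2,4,5) by metis
      then have "g \<subseteq> e" and "card g = 2" and "card e = 2"
        using assms ef g xy unfolding finite_simple_graph_def by auto
      then have "g = e"
        by (metis card_subset_eq card.infinite zero_neq_numeral)
      then show ?thesis
        using ef by blast
    qed
    then have "{e \<in> E. e \<subseteq> \<Union>{e \<in> E. c e = i}} = {e \<in> E. c e = i}"
      by blast
    moreover have "matching E {e \<in> E. c e = i}"
      using D unfolding matching_def by blast
    ultimately show ?thesis
      unfolding induced_matching_def by blast
  qed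
  then show "strong_edge_coloring E c"
    using D unfolding strong_edge_coloring_def proper_edge_coloring_def by blast
qed

text \<open>The minimum defining the strong chromatic index is attained.\<close>

lemma strong_chromatic_index_attained:
  fixes V :: "'a set"
  assumes "finite_simple_graph V E"
  shows "\<exists>c :: 'a set \<Rightarrow> nat. strong_edge_coloring E c \<and> card (c ` E) = strong_chromatic_index E"
proof -
  have "E \<subseteq> Pow V" and "finite V"
    using assms unfolding finite_simple_graph_def by auto
  then have "finite E"
    using finite_subset by blast
  then obtain c :: "'a set \<Rightarrow> nat" where "inj_on c E"
    using finite_imp_inj_to_nat_seg by blast
  then have "strong_edge_coloring E c"
    unfolding strong_edge_coloring_iff_distance[OF assms] by (auto dest: inj_onD)
  then have "\<exists>k. \<exists>c :: 'a set \<Rightarrow> nat. strong_edge_coloring E c \<and> card (c ` E) = k"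
    by blast
  then show ?thesis
    unfolding strong_chromatic_index_def by (rule LeastI_ex)
qed

end

theory Submission
  imports Defs
begin

text \<open>Call two edges near if they must receive distinct colors. The degree condition leaves at most 7
  edges near any edge. Let the graph be connected, and let \<open>S\<close> be a set of edges none of which is
  isolated in \<open>S\<close>. Coloring the remaining edges from the outside towards \<open>S\<close>, each edge still has two
  uncolored near edges when its turn comes, so at most 5 colors are forbidden and six suffice outside
  \<open>S\<close>. Everything thus reduces to finding a small \<open>S\<close> onto which such a coloring extends.

  If there is a vertex of degree 1 or a path of three vertices of degree 2, two edges are enough.
  Otherwise take as \<open>S\<close> the three edges around an edge between vertices of degree 2, or, if there is no
  such edge, a 4-cycle with the two edges leaving it, or the six edges at distance at most one from a
  vertex \<open>r\<close> of degree 3. The extension can only fail when certain color sets coincide; recoloring at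
  most three edges near a vertex of degree 3 destroys the coincidence.\<close>

section \<open>Extending partial 6-colorings of a conflict relation\<close>

text \<open>The conflict relation is left abstract, so that each extension lemma becomes a list
  coloring problem on a few elements. For the graph it is instantiated with
  \<open>near E\<close>.\<close>

definition proper6 :: "('e \<Rightarrow> 'e \<Rightarrow> bool) \<Rightarrow> 'e set \<Rightarrow> ('e \<Rightarrow> nat) \<Rightarrow> bool" where
  "proper6 R F c \<longleftrightarrow> (\<forall>e\<in>F. c e < 6) \<and> (\<forall>e\<in>F. \<forall>f\<in>F. R e f \<longrightarrow> c e \<noteq> c f)"

lemma proper6_combine:
  assumes "symp R" "proper6 R (E - S) c"
    and "\<And>e. e \<in> S \<Longrightarrow> d e < 6"
    and "\<And>e f. e \<in> S \<Longrightarrow> f \<in> E - S \<Longrightarrow> R e f \<Longrightarrow> d e \<noteq> c f"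
    and "\<And>e f. e \<in> S \<Longrightarrow> f \<in> S \<Longrightarrow> R e f \<Longrightarrow> d e \<noteq> d f"
  shows "proper6 R E (\<lambda>e. if e \<in> S then d e else c e)"
  using assms unfolding proper6_def symp_def by auto (metis DiffI)+

lemma proper6_update:
  assumes "symp R" "irreflp R" "proper6 R (E - insert e S) c" "z < 6"
    and "z \<notin> c ` {f \<in> E - insert e S. R e f}"
  shows "proper6 R (E - S) (c(e := z))"
  using assms unfolding proper6_def symp_def irreflp_def
  by (auto simp: image_iff)

lemma proper6_neq: "proper6 R F c \<Longrightarrow> R e f \<Longrightarrow> e \<in> F \<Longrightarrow> f \<in> F \<Longrightarrow> c e \<noteq> c f"
  unfolding proper6_def by blast

lemma proper6_mono: "proper6 R F c \<Longrightarrow> G \<subseteq> F \<Longrightarrow> proper6 R G c"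
  unfolding proper6_def by blast

lemma Diff_cancel_left: "X \<subseteq> U \<Longrightarrow> Y \<subseteq> U \<Longrightarrow> U - X = U - Y \<Longrightarrow> X = Y"
  by blast

section \<open>Counting free colors and choosing distinct representatives\<close>

lemma card_free_colors:
  assumes "finite X" "card X \<le> k"
  shows "6 - k \<le> card ({..<6::nat} - c ` X)"
proof -
  have "card (c ` X) \<le> k" using assms card_image_le le_trans by blast
  moreover have "card {..<6::nat} - card (c ` X) \<le> card ({..<6} - c ` X)"
    using assms by (intro diff_card_le_card_Diff) auto
  ultimately show ?thesis by auto
qed


lemma ex_free_color:
  assumes "finite X" "card X \<le> 5"
  shows "\<exists>z<6::nat. z \<notin> c ` X"
proof (rule ccontr)
  assume "\<not> ?thesis"
  then have "{..<6} - c ` X = {}" by auto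
  then have "card ({..<6} - c ` X) = 0" by (simp only: card.empty)
  then show False using card_free_colors[OF assms, of c] by linarith
qed

lemma card_ge2_ex:
  assumes "card L \<ge> 2" shows "\<exists>z\<in>L. z \<noteq> a"
proof (rule ccontr)
  assume "\<not> ?thesis"
  then have "L \<subseteq> {a}" by auto
  then have "card L \<le> card {a}" by (intro card_mono) auto
  then show False using assms by auto
qed

lemma card_ge2_ex2:
  assumes "card L \<ge> 2" shows "\<exists>a\<in>L. \<exists>b\<in>L. a \<noteq> b"
proof -
  obtain a where "a \<in> L" using card_ge2_ex[OF assms] by blast
  then show ?thesis using card_ge2_ex[OF assms, of a] by blast
qed

lemma card_ge3_ex:
  assumes "card L \<ge> 3" shows "\<exists>z\<in>L. z \<noteq> a \<and> z \<noteq> b"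
proof (rule ccontr)
  assume "\<not> ?thesis"
  then have "L \<subseteq> {a, b}" by auto
  then have "card L \<le> card {a, b}" by (intro card_mono) auto
  also have "\<dots> \<le> 2" by (simp add: card_insert_if)
  finally show False using assms by auto
qed

text \<open>Hall's condition for three sets of size at least two fails only if all three are the
  same pair. A set with three or more elements chooses last. If all are pairs, some element lies in
  one set but not in another, so choosing it leaves that other set both its elements.\<close>

lemma distinct_representatives3:
  fixes L1 L2 L3 :: "'b set"
  assumes "card L1 \<ge> 2" "card L2 \<ge> 2" "card L3 \<ge> 2"
    and ne: "\<not> (L1 = L2 \<and> L2 = L3 \<and> card L1 = 2)"
  shows "\<exists>z1\<in>L1. \<exists>z2\<in>L2. \<exists>z3\<in>L3. z1 \<noteq> z2 \<and> z1 \<noteq> z3 \<and> z2 \<noteq> z3"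
proof -
  have big: "\<exists>x\<in>A. \<exists>y\<in>B. \<exists>z\<in>C. x \<noteq> y \<and> x \<noteq> z \<and> y \<noteq> z"
    if L: "card A \<ge> 3" "card B \<ge> 2" "card C \<ge> 2" for A B C :: "'b set"
  proof -
    obtain y where "y \<in> B" using card_ge2_ex[OF L(2)] by blast
    moreover obtain z where "z \<in> C" "z \<noteq> y" using card_ge2_ex[OF L(3)] by blast
    ultimately show ?thesis using card_ge3_ex[OF L(1)] by metis
  qed
  have differ: "\<exists>x\<in>A. \<exists>y\<in>B. \<exists>z\<in>C. x \<noteq> y \<and> x \<noteq> z \<and> y \<noteq> z"
    if L: "\<not> A \<subseteq> B" "card B \<ge> 2" "card C \<ge> 2" for A B C :: "'b set"
  proof -
    obtain x where "x \<in> A" "x \<notin> B" using L(1) by blast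
    moreover obtain z where "z \<in> C" "z \<noteq> x" using card_ge2_ex[OF L(3)] by blast
    ultimately show ?thesis using card_ge2_ex[OF L(2), of z] by metis
  qed
  show ?thesis
  proof (cases "card L1 = 2 \<and> card L2 = 2 \<and> card L3 = 2")
    case True
    then have fin: "finite L1" "finite L2" "finite L3"
      by (metis card.infinite zero_neq_numeral)+
    from True ne fin have "\<not> L1 \<subseteq> L2 \<or> \<not> L2 \<subseteq> L3"
      by (metis card_subset_eq)
    then show ?thesis
      using differ[of L1 L2 L3] differ[of L2 L3 L1] assms by metis
  next
    case False
    then consider "card L1 \<ge> 3" | "card L2 \<ge> 3" | "card L3 \<ge> 3" using assms by linarith
    then show ?thesis
    proof cases
      case 1
      from big[OF 1 assms(2,3)] show ?thesis .
    next
      case 2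
      from big[OF 2 assms(1,3)] show ?thesis by (metis (no_types))
    next
      case 3
      from big[OF 3 assms(1,2)] show ?thesis by (metis (no_types))
    qed
  qed
qed

section \<open>Extension onto the uncolored edges of each configuration\<close>

text \<open>Each \<open>s\<close> keeps at least two free colors, and distinct representatives of
  these lists are wanted. All forbidden colors lie below 6, so equal lists mean equal forbidden
  sets, and \<open>ne\<close> rules out precisely the bad case of
  \<open>distinct_representatives3\<close>.\<close>

lemma proper6_extend_triangle:
  assumes R: "symp R" "irreflp R"
    and c: "proper6 R (E - {s1, s2, s3}) c"
    and dist: "distinct [s1, s2, s3]"
    and N: "{x. R s1 x} \<subseteq> {s1, s2, s3} \<union> X1" "{x. R s2 x} \<subseteq> {s1, s2, s3} \<union> X2"
      "{x. R s3 x} \<subseteq> {s1, s2, s3} \<union> X3"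
    and X: "finite X1" "finite X2" "finite X3" "card X1 \<le> 4" "card X2 \<le> 4" "card X3 \<le> 4"
    and XE: "X1 \<subseteq> E - {s1, s2, s3}" "X2 \<subseteq> E - {s1, s2, s3}" "X3 \<subseteq> E - {s1, s2, s3}"
    and ne: "\<not> (c ` X1 = c ` X2 \<and> c ` X2 = c ` X3 \<and> card (c ` X1) = 4)"
  shows "\<exists>d. proper6 R E d"
proof -
  let ?L = "\<lambda>X. {..<6} - c ` X"
  have sub: "c ` X1 \<subseteq> {..<6}" "c ` X2 \<subseteq> {..<6}" "c ` X3 \<subseteq> {..<6}"
    using c XE unfolding proper6_def by blast+
  have L2: "card (?L X1) \<ge> 2" "card (?L X2) \<ge> 2" "card (?L X3) \<ge> 2"
    using card_free_colors[of X1 4 c] card_free_colors[of X2 4 c] card_free_colors[of X3 4 c] X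
    by auto
  have "\<not> (?L X1 = ?L X2 \<and> ?L X2 = ?L X3 \<and> card (?L X1) = 2)"
  proof
    assume *: "?L X1 = ?L X2 \<and> ?L X2 = ?L X3 \<and> card (?L X1) = 2"
    then have "c ` X1 = c ` X2" "c ` X2 = c ` X3"
      using Diff_cancel_left[OF sub(1,2)] Diff_cancel_left[OF sub(2,3)] by simp_all
    moreover have "card (c ` X1) = 4"
      using card_Diff_subset[of "c ` X1" "{..<6}"] * sub(1) X(1) card_mono[OF _ sub(1)] by auto
    ultimately show False using ne by auto
  qed
  from distinct_representatives3[OF L2 this] obtain z1 z2 z3 where z: "z1 \<in> ?L X1" "z2 \<in> ?L X2" "z3 \<in> ?L X3"
    "z1 \<noteq> z2" "z1 \<noteq> z3" "z2 \<noteq> z3" by blast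
  let ?d = "\<lambda>e. if e = s1 then z1 else if e = s2 then z2 else z3"
  have "proper6 R E (\<lambda>e. if e \<in> {s1, s2, s3} then ?d e else c e)"
  proof (rule proper6_combine[OF R(1) c])
    fix e assume "e \<in> {s1, s2, s3}" then show "?d e < 6" using z by auto
  next
    fix e f assume "e \<in> {s1, s2, s3}" "f \<in> E - {s1, s2, s3}" "R e f"
    then show "?d e \<noteq> c f" using z N dist by auto
  next
    fix e f assume "e \<in> {s1, s2, s3}" "f \<in> {s1, s2, s3}" "R e f"
    then show "?d e \<noteq> ?d f" using z dist R(2) unfolding irreflp_def by auto
  qed
  then show ?thesis by blast
qed

text \<open>The lists that remain around a vertex \<open>r\<close> of degree 3: \<open>z\<^sub>i\<close> is the color of the edge from \<open>r\<close> to its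
  neighbor \<open>a\<^sub>i\<close>, and \<open>p\<^sub>i\<close> that of the other edge at \<open>a\<^sub>i\<close>. Either two of the \<open>M\<^sub>i\<close> meet, so that only two
  colors are spent on the \<open>p\<^sub>i\<close>, or they are disjoint and a second color of \<open>M\<^sub>i\<close> serves as \<open>z\<^sub>i\<close>.\<close>

lemma star_lists:
  fixes B1 B2 B3 M1 M2 M3 :: "nat set"
  assumes B: "B1 \<subseteq> {..<6}" "B2 \<subseteq> {..<6}" "B3 \<subseteq> {..<6}" "card B1 \<le> 2" "card B2 \<le> 2" "card B3 \<le> 2"
    and M: "M1 \<subseteq> {..<6} - B1" "M2 \<subseteq> {..<6} - B2" "M3 \<subseteq> {..<6} - B3"
      "card M1 \<ge> 2" "card M2 \<ge> 2" "card M3 \<ge> 2"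
    and ne: "\<not> (B1 = B2 \<and> B2 = B3)"
  obtains p1 p2 p3 z1 z2 z3 where "p1 \<in> M1" "p2 \<in> M2" "p3 \<in> M3"
    "z1 \<in> {..<6} - B1" "z2 \<in> {..<6} - B2" "z3 \<in> {..<6} - B3"
    "{z1, z2, z3} \<inter> {p1, p2, p3} = {}" "z1 \<noteq> z2" "z1 \<noteq> z3" "z2 \<noteq> z3"
proof -
  \<comment> \<open>The case where only two colors \<open>p\<close>, \<open>q\<close> are spent:
    each list of at least four colors loses at most two, and distinct representatives of the rest
    are chosen.\<close>
  have two: "\<exists>z1\<in>{..<6} - B1. \<exists>z2\<in>{..<6} - B2. \<exists>z3\<in>{..<6} - B3.
    {z1, z2, z3} \<inter> {p, q} = {} \<and> z1 \<noteq> z2 \<and> z1 \<noteq> z3 \<and> z2 \<noteq> z3" for p q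
  proof -
    have four: "card ({..<6} - B) \<ge> 4" if "B \<subseteq> {..<6::nat}" "card B \<le> 2" for B
      using card_Diff_subset[of B "{..<6}"] that finite_subset[of B "{..<6}"] by auto
    have ge2: "card ({..<6} - B - {p, q}) \<ge> 2" if "B \<subseteq> {..<6::nat}" "card B \<le> 2" for B
    proof -
      have "card ({..<6} - B) - card {p, q} \<le> card ({..<6} - B - {p, q})"
        by (intro diff_card_le_card_Diff) auto
      moreover have "card {p, q} \<le> 2" by (simp add: card_insert_if)
      ultimately show ?thesis using four[OF that] by linarith
    qed
    \<comment> \<open>If only two colors remain, both \<open>p\<close> and \<open>q\<close> were in
      the list, so the original list can be recovered from the remainder. Three equal remainders
      would thus force \<open>B1 = B2 = B3\<close>.\<close>
    have full: "{..<6} - B = T \<union> {p, q}"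
      if "B \<subseteq> {..<6::nat}" "card B \<le> 2" "{..<6} - B - {p, q} = T" "card T = 2" for B T
    proof -
      have "finite T" using that(3) by auto
      have "card (T \<union> {p, q}) \<le> card T + card {p, q}" by (rule card_Un_le)
      moreover have "card {p, q} \<le> 2" by (simp add: card_insert_if)
      ultimately have "card (T \<union> {p, q}) \<le> card ({..<6} - B)"
        using four[OF that(1,2)] that(4) by linarith
      moreover have "{..<6} - B \<subseteq> T \<union> {p, q}" using that(3) by blast
      ultimately show ?thesis using \<open>finite T\<close> by (metis card_seteq finite.emptyI finite.insertI finite_UnI)
    qed
    have "\<not> ({..<6} - B1 - {p, q} = {..<6} - B2 - {p, q} \<and> {..<6} - B2 - {p, q} = {..<6} - B3 - {p, q}
      \<and> card ({..<6} - B1 - {p, q}) = 2)"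
    proof
      assume *: "{..<6} - B1 - {p, q} = {..<6} - B2 - {p, q} \<and> {..<6} - B2 - {p, q} = {..<6} - B3 - {p, q}
      \<and> card ({..<6} - B1 - {p, q}) = 2"
      then have "{..<6} - B1 = {..<6} - B2" "{..<6} - B2 = {..<6} - B3"
        using full[OF B(1,4) refl] full[OF B(2,5) refl] full[OF B(3,6) refl] by metis+
      then show False
        using Diff_cancel_left[OF B(1,2)] Diff_cancel_left[OF B(2,3)] ne by simp
    qed
    from distinct_representatives3[OF ge2[OF B(1,4)] ge2[OF B(2,5)] ge2[OF B(3,6)] this]
    show ?thesis by blast
  qed
  obtain p1 p1' where p1: "p1 \<in> M1" "p1' \<in> M1" "p1 \<noteq> p1'"
    using card_ge2_ex2[OF M(4)] by blast
  obtain p2 p2' where p2: "p2 \<in> M2" "p2' \<in> M2" "p2 \<noteq> p2'"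
    using card_ge2_ex2[OF M(5)] by blast
  obtain p3 p3' where p3: "p3 \<in> M3" "p3' \<in> M3" "p3 \<noteq> p3'"
    using card_ge2_ex2[OF M(6)] by blast
  consider p where "p \<in> M1" "p \<in> M2" | p where "p \<in> M1" "p \<in> M3" | p where "p \<in> M2" "p \<in> M3"
    | "M1 \<inter> M2 = {}" "M1 \<inter> M3 = {}" "M2 \<inter> M3 = {}" by blast
  then show ?thesis
  proof cases
    case 1
    obtain z1 z2 z3 where "z1 \<in> {..<6} - B1" "z2 \<in> {..<6} - B2" "z3 \<in> {..<6} - B3"
      "{z1, z2, z3} \<inter> {p, p3} = {}" "z1 \<noteq> z2" "z1 \<noteq> z3" "z2 \<noteq> z3"
      using two[of p p3] by blast
    with that[of p p p3 z1 z2 z3] 1 p3(1) show ?thesis by simp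
  next
    case 2
    obtain z1 z2 z3 where "z1 \<in> {..<6} - B1" "z2 \<in> {..<6} - B2" "z3 \<in> {..<6} - B3"
      "{z1, z2, z3} \<inter> {p, p2} = {}" "z1 \<noteq> z2" "z1 \<noteq> z3" "z2 \<noteq> z3"
      using two[of p p2] by blast
    with that[of p p2 p z1 z2 z3] 2 p2(1) show ?thesis by simp
  next
    case 3
    obtain z1 z2 z3 where "z1 \<in> {..<6} - B1" "z2 \<in> {..<6} - B2" "z3 \<in> {..<6} - B3"
      "{z1, z2, z3} \<inter> {p, p1} = {}" "z1 \<noteq> z2" "z1 \<noteq> z3" "z2 \<noteq> z3"
      using two[of p p1] by blast
    with that[of p1 p p z1 z2 z3] 3 p1(1) show ?thesis by simp
  next
    case 4
    then have "{p1', p2', p3'} \<inter> {p1, p2, p3} = {}" "p1' \<noteq> p2'" "p1' \<noteq> p3'" "p2' \<noteq> p3'"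
      using p1 p2 p3 by blast+
    then show ?thesis using that[of p1 p2 p3 p1' p2' p3'] p1 p2 p3 M(1-3) by blast
  qed
qed

text \<open>If \<open>e\<close> and \<open>f\<close> alone cannot be recolored, then each of the four remaining colors occurs exactly once
  among the colored edges near \<open>e\<close>. Hence giving \<open>g\<close> a new color frees its old one for \<open>e\<close>.\<close>

lemma recolor_pair:
  assumes R: "symp R" "irreflp R"
    and c: "proper6 R (E - S) c"
    and deg: "\<And>x. x \<in> E \<Longrightarrow> finite {y \<in> E. R x y} \<and> card {y \<in> E. R x y} \<le> 7"
    and efg: "e \<in> E - S" "f \<in> E - S" "g \<in> E - S"
    and s: "s1 \<in> S" "s2 \<in> S" "s1 \<in> E" "s2 \<in> E" "s1 \<noteq> s2"
    and adj: "R e f" "R e g" "R f g" "R e s1" "R e s2" "R f s1" "R f s2" "R g s1"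
  obtains c' where "proper6 R (E - S) c'" "\<And>x. x \<notin> {e, f, g} \<Longrightarrow> c' x = c x"
    "{c' e, c' f} \<noteq> {c e, c f}"
proof -
  note result = that
  define Ne where "Ne = {y \<in> E - S - {e, f}. R e y}"
  define Nf where "Nf = {y \<in> E - S - {e, f}. R f y}"
  define Ng where "Ng = {y \<in> E - S - {e, f, g}. R g y}"
  have sym: "R y x" if "R x y" for x y using R(1) that by (rule sympD)
  have irr: "\<not> R x x" for x using R(2) by (rule irreflpD)
  have ne: "e \<noteq> f" "e \<noteq> g" "f \<noteq> g" using adj irr by metis+
  \<comment> \<open>Three of the at most 7 elements in conflict with \<open>x\<close> are discounted
    because they are uncolored or about to lose their color. Four forbidden colors leave at least
    two free ones.\<close>
  have four: "finite N \<and> card N \<le> 4"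
    if "x \<in> E" "N \<subseteq> {y \<in> E. R x y} - {a, b, d}" "{a, b, d} \<subseteq> {y \<in> E. R x y}"
      "a \<noteq> b" "a \<noteq> d" "b \<noteq> d" for x N a b d
  proof -
    have "card ({y \<in> E. R x y} - {a, b, d}) = card {y \<in> E. R x y} - card {a, b, d}"
      using that(3) by (intro card_Diff_subset) auto
    also have "card {a, b, d} = 3" using that(4-6) by simp
    also have "card {y \<in> E. R x y} - 3 \<le> 4" using deg[OF that(1)] by linarith
    finally have "card ({y \<in> E. R x y} - {a, b, d}) \<le> 4" .
    moreover have "finite ({y \<in> E. R x y} - {a, b, d})" using deg[OF that(1)] by simp
    ultimately show ?thesis using that(2) by (meson card_mono finite_subset le_trans)
  qed
  have Ne4: "finite Ne \<and> card Ne \<le> 4"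
    by (rule four[of e _ f s1 s2]) (use adj s efg ne in \<open>auto simp: Ne_def\<close>)
  have Nf4: "finite Nf \<and> card Nf \<le> 4"
    by (rule four[of f _ e s1 s2]) (use adj s efg ne sym in \<open>auto simp: Nf_def\<close>)
  have Ng4: "finite Ng \<and> card Ng \<le> 4"
    by (rule four[of g _ e f s1]) (use adj s efg ne sym in \<open>auto simp: Ng_def\<close>)
  have free: "card ({..<6} - d ` N) \<ge> 2" if "finite N \<and> card N \<le> 4" for d :: "_ \<Rightarrow> nat" and N
    using card_free_colors[of N 4 d] that by simp
  \<comment> \<open>The last move shared by both cases: \<open>d\<close> is \<open>c\<close>,
    possibly after recoloring \<open>g\<close>, and \<open>e\<close>, \<open>f\<close> receive
    distinct free colors other than the old pair.\<close>
  have step: thesis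
    if d: "proper6 R (E - S - {e, f}) d" "\<And>x. x \<notin> {e, f, g} \<Longrightarrow> d x = c x"
      and zw: "z \<in> {..<6} - d ` Ne" "w \<in> {..<6} - d ` Nf" "z \<noteq> w" "{z, w} \<noteq> {c e, c f}" for d z w
  proof (rule result)
    show "proper6 R (E - S) (d(e := z, f := w))"
      unfolding proper6_def
    proof (intro conjI ballI impI)
      fix x assume "x \<in> E - S"
      then show "(d(e := z, f := w)) x < 6" using d(1) zw unfolding proper6_def by auto
    next
      fix x y assume xy: "x \<in> E - S" "y \<in> E - S" "R x y"
      have e: "d y \<noteq> z" if "R e y" "y \<in> E - S" "y \<notin> {e, f}" for y
        using zw(1) that unfolding Ne_def by auto
      have f: "d y \<noteq> w" if "R f y" "y \<in> E - S" "y \<notin> {e, f}" for y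
        using zw(2) that unfolding Nf_def by auto
      have o: "d x \<noteq> d y" if "x \<notin> {e, f}" "y \<notin> {e, f}"
        using d(1) that xy unfolding proper6_def by auto
      show "(d(e := z, f := w)) x \<noteq> (d(e := z, f := w)) y"
        using xy e[of x] e[of y] f[of x] f[of y] o ne sym[of x y] irr zw(3) by (auto split: if_splits)
    qed
    show "\<And>x. x \<notin> {e, f, g} \<Longrightarrow> (d(e := z, f := w)) x = c x" using d(2) by auto
    show "{(d(e := z, f := w)) e, (d(e := z, f := w)) f} \<noteq> {c e, c f}" using zw(4) ne by auto
  qed
  have c0: "proper6 R (E - S - {e, f}) c" by (rule proper6_mono[OF c]) blast
  show thesis
  proof (cases "{..<6} - c ` Ne \<subseteq> {c e, c f}")
    case False
    then obtain z where z: "z \<in> {..<6} - c ` Ne" "z \<notin> {c e, c f}" by blast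
    obtain w where "w \<in> {..<6} - c ` Nf" "w \<noteq> z"
      using card_ge2_ex[OF free[OF Nf4, of c], of z] by blast
    then show thesis using step[OF c0 _ z(1), of w] z(2) by auto
  next
    case True
    have "card ({..<6} - c ` Ne) \<le> card {c e, c f}" using True by (intro card_mono) auto
    also have "\<dots> \<le> 2" by (simp add: card_insert_if)
    finally have "card {..<6::nat} - card (c ` Ne) \<le> 2"
      using diff_card_le_card_Diff[of "c ` Ne" "{..<6}"] Ne4 by simp
    then have "card (c ` Ne) \<ge> card Ne" using Ne4 unfolding card_lessThan by linarith
    then have inj: "inj_on c Ne"
      using Ne4 card_image_le[of Ne c] by (intro eq_card_imp_inj_on) auto
    \<comment> \<open>\<open>Ng\<close> omits \<open>e\<close> and \<open>f\<close>, so
      \<open>z\<close> may clash with their present colors; this is harmless because both are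
      replaced afterwards.\<close>
    obtain z where z: "z \<in> {..<6} - c ` Ng" "z \<noteq> c g" 
      using card_ge2_ex[OF free[OF Ng4, of c], of "c g"] by blast
    let ?d = "c(g := z)"
    have d: "proper6 R (E - S - {e, f}) ?d"
      unfolding proper6_def
    proof (intro conjI ballI impI)
      fix x assume "x \<in> E - S - {e, f}"
      then show "?d x < 6" using c z unfolding proper6_def by auto
    next
      fix x y assume xy: "x \<in> E - S - {e, f}" "y \<in> E - S - {e, f}" "R x y"
      have g: "c y \<noteq> z" if "R g y" "y \<in> E - S - {e, f, g}" for y
        using z(1) that unfolding Ng_def by auto
      have o: "c x \<noteq> c y" using c xy unfolding proper6_def by auto
      show "?d x \<noteq> ?d y"
        using xy g[of x] g[of y] o sym[of x y] irr by auto
    qed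
    have gNe: "g \<in> Ne" using efg adj ne unfolding Ne_def by auto
    have z': "c g \<in> {..<6} - ?d ` Ne"
      using inj gNe z(2) c efg(3) unfolding proper6_def by (auto simp: inj_on_def)
    obtain w where w: "w \<in> {..<6} - ?d ` Nf" "w \<noteq> c g" 
      using card_ge2_ex[OF free[OF Nf4, of ?d], of "c g"] by blast
    have "c g \<noteq> c e" "c g \<noteq> c f" using c efg adj unfolding proper6_def by metis+
    then show thesis using step[OF d _ z' w(1)] w(2) by auto
  qed
qed

text \<open>Here \<open>r1\<close>, \<open>r2\<close>, \<open>r3\<close> are the edges at the center
  and \<open>t1\<close>, \<open>t2\<close>, \<open>t3\<close> continue them. An \<open>r\<close>
  sees only the two colored edges of its \<open>F\<close>, a \<open>t\<close> also those of its
  \<open>G\<close>, and the \<open>t\<close> may share colors among themselves. This is the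
  situation of \<open>star_lists\<close>, with the colors of \<open>F1\<close>, \<open>F2\<close>,
  \<open>F3\<close> as the sets \<open>B1\<close>, \<open>B2\<close>, \<open>B3\<close>.\<close>

lemma proper6_extend_star:
  assumes R: "symp R" "irreflp R"
    and S: "S = {r1, r2, r3, t1, t2, t3}" and dist: "distinct [r1, r2, r3, t1, t2, t3]"
    and c: "proper6 R (E - S) c"
    and Nr: "{x. R r1 x} \<subseteq> S \<union> F1" "{x. R r2 x} \<subseteq> S \<union> F2" "{x. R r3 x} \<subseteq> S \<union> F3"
    and Nt: "{x. R t1 x} \<subseteq> S \<union> F1 \<union> G1" "{x. R t2 x} \<subseteq> S \<union> F2 \<union> G2" "{x. R t3 x} \<subseteq> S \<union> F3 \<union> G3"
    and fin: "finite F1" "finite F2" "finite F3" "finite G1" "finite G2" "finite G3"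
    and F: "card F1 \<le> 2" "card F2 \<le> 2" "card F3 \<le> 2"
    and G: "card G1 \<le> 2" "card G2 \<le> 2" "card G3 \<le> 2"
    and FE: "F1 \<subseteq> E - S" "F2 \<subseteq> E - S" "F3 \<subseteq> E - S"
    and t: "\<not> R t1 t2" "\<not> R t1 t3" "\<not> R t2 t3"
    and ne: "\<not> (c ` F1 = c ` F2 \<and> c ` F2 = c ` F3)"
  shows "\<exists>d. proper6 R E d"
proof -
  have sym: "R y x" if "R x y" for x y using R(1) that by (rule sympD)
  have irr: "\<not> R x x" for x using R(2) by (rule irreflpD)
  have B: "c ` F1 \<subseteq> {..<6}" "c ` F2 \<subseteq> {..<6}" "c ` F3 \<subseteq> {..<6}"
    using c FE unfolding proper6_def by blast+
  have B2: "card (c ` F1) \<le> 2" "card (c ` F2) \<le> 2" "card (c ` F3) \<le> 2"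
    using F fin card_image_le le_trans by blast+
  have M2: "card ({..<6} - c ` (F \<union> G)) \<ge> 2"
    if "finite F" "finite G" "card F \<le> 2" "card G \<le> 2" for F G
  proof -
    have "card (F \<union> G) \<le> 4" using card_Un_le[of F G] that by linarith
    then show ?thesis using card_free_colors[of "F \<union> G" 4 c] that by simp
  qed
  obtain p1 p2 p3 z1 z2 z3 where
    p: "p1 \<in> {..<6} - c ` (F1 \<union> G1)" "p2 \<in> {..<6} - c ` (F2 \<union> G2)" "p3 \<in> {..<6} - c ` (F3 \<union> G3)"
    and z: "z1 \<in> {..<6} - c ` F1" "z2 \<in> {..<6} - c ` F2" "z3 \<in> {..<6} - c ` F3"
    and zp: "{z1, z2, z3} \<inter> {p1, p2, p3} = {}" "z1 \<noteq> z2" "z1 \<noteq> z3" "z2 \<noteq> z3"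
    by (rule star_lists[OF B B2 _ _ _ M2[OF fin(1,4) F(1) G(1)] M2[OF fin(2,5) F(2) G(2)]
          M2[OF fin(3,6) F(3) G(3)] ne]) auto
  define d where "d = (\<lambda>e. if e = r1 then z1 else if e = r2 then z2 else if e = r3 then z3
    else if e = t1 then p1 else if e = t2 then p2 else p3)"
  have val: "d r1 = z1" "d r2 = z2" "d r3 = z3" "d t1 = p1" "d t2 = p2" "d t3 = p3"
    using dist by (auto simp: d_def)
  have "proper6 R E (\<lambda>e. if e \<in> S then d e else c e)"
  proof (rule proper6_combine[OF R(1) c])
    fix e assume "e \<in> S" then show "d e < 6" using z p val S by auto
  next
    fix e f assume e: "e \<in> S" and f: "f \<in> E - S" "R e f"
    have fN: "c f \<noteq> z" if "{x. R e x} \<subseteq> S \<union> F" "z \<in> {..<6} - c ` F" for z F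
      using that f by auto
    consider "e = r1" | "e = r2" | "e = r3" | "e = t1" | "e = t2" | "e = t3" using e S by blast
    then have "c f \<noteq> d e"
    proof cases
      case 1 show ?thesis unfolding 1 val by (rule fN[OF _ z(1)]) (use Nr 1 in auto)
    next
      case 2 show ?thesis unfolding 2 val by (rule fN[OF _ z(2)]) (use Nr 2 in auto)
    next
      case 3 show ?thesis unfolding 3 val by (rule fN[OF _ z(3)]) (use Nr 3 in auto)
    next
      case 4 show ?thesis unfolding 4 val by (rule fN[OF _ p(1)]) (use Nt 4 in auto)
    next
      case 5 show ?thesis unfolding 5 val by (rule fN[OF _ p(2)]) (use Nt 5 in auto)
    next
      case 6 show ?thesis unfolding 6 val by (rule fN[OF _ p(3)]) (use Nt 6 in auto)
    qed
    then show "d e \<noteq> c f" by (rule not_sym)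
  next
    fix e f assume ef: "e \<in> S" "f \<in> S" "R e f"
    have "\<forall>e\<in>{r1, r2, r3, t1, t2, t3}. \<forall>f\<in>{r1, r2, r3, t1, t2, t3}.
      d e = d f \<longrightarrow> e = f \<or> {e, f} \<subseteq> {t1, t2, t3}"
      by (simp only: ball_simps val) (use zp in auto)
    then have "d e = d f \<longrightarrow> e = f \<or> {e, f} \<subseteq> {t1, t2, t3}"
      using ef(1,2) unfolding S by blast
    moreover have "e \<noteq> f" using ef(3) irr by metis
    moreover have "\<not> (e \<in> {t1, t2, t3} \<and> f \<in> {t1, t2, t3})"
      using t sym irr ef(3) by blast
    ultimately show "d e \<noteq> d f" by auto
  qed
  then show ?thesis by blast
qed

text \<open>\<open>X\<close> and \<open>Y\<close> are the lists of the two edges leaving a 4-cycle,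
  \<open>s\<close> and \<open>s'\<close> the colors just beyond these edges. The cycle needs four
  distinct colors different from \<open>a\<close> and \<open>b\<close>, with \<open>s\<close> and
  \<open>s'\<close> each forbidden on one half of it.\<close>

lemma square_lists:
  fixes X Y :: "nat set"
  assumes X: "X \<subseteq> {..<6}" "Y \<subseteq> {..<6}" "card X \<ge> 3" "card Y \<ge> 3" and s: "s \<notin> X" "s' \<notin> Y" "s < 6" "s' < 6"
  obtains a b k1 k2 k3 k4 where "a \<in> X" "b \<in> Y" "{k1, k2, k3, k4} \<subseteq> {..<6}" "distinct [k1, k2, k3, k4]"
    "{k1, k2, k3, k4} \<inter> {a, b} = {}" "s \<notin> {k1, k2}" "s' \<notin> {k3, k4}"
proof -
  have pick: "\<exists>x\<in>R. x \<notin> set l" if "card R \<ge> 4" "length l < 4" for R :: "nat set" and l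
  proof (rule ccontr)
    assume "\<not> ?thesis"
    then have "card R \<le> card (set l)" by (intro card_mono) auto
    then show False using that card_length[of l] by linarith
  qed
  have four: "card ({..<6} - {a, b::nat}) \<ge> 4" for a b
    using card_free_colors[of "{a, b}" 2 id] by (simp add: card_insert_if)
  show thesis
  proof (cases "s = s'")
    case True
    \<comment> \<open>Both lists lie among the five colors other than \<open>s\<close>, so they
      meet. A common color for both leaving edges keeps four colors for the cycle even after
      \<open>s\<close> is removed.\<close>
    have "X \<inter> Y \<noteq> {}"
    proof
      assume dis: "X \<inter> Y = {}"
      have fin: "finite X" "finite Y" using X finite_subset by blast+
      have "card (X \<union> Y) \<le> card ({..<6} - {s})"
        using X s True by (intro card_mono) auto
      also have "\<dots> = 5" using s(3) by simp
      finally show False using card_Un_disjoint[OF fin dis] X by linarith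
    qed
    then obtain a where a: "a \<in> X" "a \<in> Y" by blast
    let ?R = "{..<6} - {a, s}"
    have R: "card ?R \<ge> 4" using four .
    obtain k1 where k1: "k1 \<in> ?R" using pick[OF R, of "[]"] by auto
    obtain k2 where k2: "k2 \<in> ?R" "k2 \<noteq> k1" using pick[OF R, of "[k1]"] by auto
    obtain k3 where k3: "k3 \<in> ?R" "k3 \<notin> {k1, k2}" using pick[OF R, of "[k1, k2]"] by auto
    obtain k4 where k4: "k4 \<in> ?R" "k4 \<notin> {k1, k2, k3}" using pick[OF R, of "[k1, k2, k3]"] by auto
    show thesis
      by (rule that[OF a, of k1 k2 k3 k4]) (use k1 k2 k3 k4 True in auto)
  next
    case False
    obtain a where a: "a \<in> X" using X(3) by fastforce
    obtain b where b: "b \<in> Y" using X(4) by fastforce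
    let ?R = "{..<6} - {a, b}"
    have R: "card ?R \<ge> 4" using four .
    \<comment> \<open>A color forbidden on one half is placed on the other: \<open>s'\<close> goes
      to \<open>k1\<close> and \<open>s\<close> to \<open>k3\<close> whenever available. The
      remaining \<open>k2\<close> and \<open>k4\<close> then avoid them automatically.\<close>
    obtain k1 where k1: "k1 \<in> ?R" "k1 \<noteq> s" "s' \<in> ?R \<longrightarrow> k1 = s'"
    proof (cases "s' \<in> ?R")
      case True then show thesis using that[of s'] False by auto
    next
      case False
      then show thesis using that pick[OF R, of "[s]"] by auto
    qed
    obtain k3 where k3: "k3 \<in> ?R" "k3 \<noteq> s'" "k3 \<noteq> k1" "s \<in> ?R \<longrightarrow> k3 = s"
    proof (cases "s \<in> ?R")
      case True then show thesis using that[of s] False k1 by auto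
    next
      case False
      then show thesis using that pick[OF R, of "[s', k1]"] by auto
    qed
    obtain k2 where k2: "k2 \<in> ?R" "k2 \<notin> {k1, k3}" using pick[OF R, of "[k1, k3]"] by auto
    obtain k4 where k4: "k4 \<in> ?R" "k4 \<notin> {k1, k3, k2}" using pick[OF R, of "[k1, k3, k2]"] by auto
    show thesis
      by (rule that[OF a b, of k1 k2 k3 k4]) (use k1 k2 k3 k4 in auto)
  qed
qed

text \<open>\<open>k1\<close>, \<open>k2\<close> are the cycle edges at the end of \<open>x\<close>,
  and \<open>k3\<close>, \<open>k4\<close> those at the end of \<open>y\<close>; \<open>s\<close>
  and \<open>s'\<close> continue \<open>x\<close> and \<open>y\<close>. Since \<open>x\<close> and
  \<open>y\<close> do not conflict, they may share a color, as \<open>square_lists\<close>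
  requires.\<close>

lemma proper6_extend_square:
  assumes R: "symp R" "irreflp R"
    and S: "S = {k1, k2, k3, k4, x, y}" and dist: "distinct [k1, k2, k3, k4, x, y]"
    and c: "proper6 R (E - S) c"
    and N: "{z. R k1 z} \<subseteq> S \<union> {s}" "{z. R k2 z} \<subseteq> S \<union> {s}" "{z. R k3 z} \<subseteq> S \<union> {s'}" "{z. R k4 z} \<subseteq> S \<union> {s'}"
    and Nx: "{z. R x z} \<subseteq> S \<union> insert s X" and Ny: "{z. R y z} \<subseteq> S \<union> insert s' Y"
    and fin: "finite X" "finite Y" and X: "card X \<le> 2" "card Y \<le> 2"
    and sE: "s \<in> E - S" "s' \<in> E - S"
    and xy: "\<not> R x y"
  shows "\<exists>d. proper6 R E d"
proof -
  have sym: "R y x" if "R x y" for x y using R(1) that by (rule sympD)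
  have irr: "\<not> R x x" for x using R(2) by (rule irreflpD)
  have three: "card ({..<6} - c ` insert s X) \<ge> 3" if "finite X" "card X \<le> 2" for s X
    using card_free_colors[of "insert s X" 3 c] that by (simp add: card_insert_if)
  have s6: "c s < 6" "c s' < 6" using c sE unfolding proper6_def by auto
  obtain a b z1 z2 z3 z4 where
    ab: "a \<in> {..<6} - c ` insert s X" "b \<in> {..<6} - c ` insert s' Y"
    and z: "{z1, z2, z3, z4} \<subseteq> {..<6}" "distinct [z1, z2, z3, z4]"
    "{z1, z2, z3, z4} \<inter> {a, b} = {}" "c s \<notin> {z1, z2}" "c s' \<notin> {z3, z4}"
    by (rule square_lists[OF _ _ three[OF fin(1) X(1)] three[OF fin(2) X(2)] _ _ s6]) auto
  define d where "d = (\<lambda>e. if e = k1 then z1 else if e = k2 then z2 else if e = k3 then z3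
    else if e = k4 then z4 else if e = x then a else b)"
  have val: "d k1 = z1" "d k2 = z2" "d k3 = z3" "d k4 = z4" "d x = a" "d y = b"
    using dist by (auto simp: d_def)
  have "proper6 R E (\<lambda>e. if e \<in> S then d e else c e)"
  proof (rule proper6_combine[OF R(1) c])
    fix e assume "e \<in> S" then show "d e < 6" using z ab val S by auto
  next
    fix e f assume e: "e \<in> S" and f: "f \<in> E - S" "R e f"
    have fN: "c f \<noteq> z" if "{x. R e x} \<subseteq> S \<union> F" "z \<notin> c ` F" for z F
      using that f by auto
    consider "e = k1" | "e = k2" | "e = k3" | "e = k4" | "e = x" | "e = y" using e S by blast
    then have "c f \<noteq> d e"
    proof cases
      case 1 show ?thesis unfolding 1 val by (rule fN[of "{s}"]) (use N z 1 in auto)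
    next
      case 2 show ?thesis unfolding 2 val by (rule fN[of "{s}"]) (use N z 2 in auto)
    next
      case 3 show ?thesis unfolding 3 val by (rule fN[of "{s'}"]) (use N z 3 in auto)
    next
      case 4 show ?thesis unfolding 4 val by (rule fN[of "{s'}"]) (use N z 4 in auto)
    next
      case 5 show ?thesis unfolding 5 val by (rule fN[of "insert s X"]) (use Nx ab 5 in auto)
    next
      case 6 show ?thesis unfolding 6 val by (rule fN[of "insert s' Y"]) (use Ny ab 6 in auto)
    qed
    then show "d e \<noteq> c f" by (rule not_sym)
  next
    fix e f assume ef: "e \<in> S" "f \<in> S" "R e f"
    have "\<forall>e\<in>{k1, k2, k3, k4, x, y}. \<forall>f\<in>{k1, k2, k3, k4, x, y}.
      d e = d f \<longrightarrow> e = f \<or> {e, f} \<subseteq> {x, y}"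
      by (simp only: ball_simps val) (use z in auto)
    then have "d e = d f \<longrightarrow> e = f \<or> {e, f} \<subseteq> {x, y}"
      using ef(1,2) unfolding S by blast
    moreover have "e \<noteq> f" using ef(3) irr by metis
    moreover have "\<not> (e \<in> {x, y} \<and> f \<in> {x, y})"
      using xy sym irr ef(3) by blast
    ultimately show "d e \<noteq> d f" by auto
  qed
  then show ?thesis by blast
qed

section \<open>Graphs whose edges have degree sum at most 5\<close>

text \<open>Since \<open>e\<close> is itself an edge, sharing a vertex with \<open>e\<close> is the case where \<open>{x, y}\<close> is \<open>e\<close>.\<close>

definition near :: "'a set set \<Rightarrow> 'a set \<Rightarrow> 'a set \<Rightarrow> bool" where
  "near E e f \<longleftrightarrow> e \<in> E \<and> f \<in> E \<and> e \<noteq> f \<and> (\<exists>x\<in>e. \<exists>y\<in>f. {x, y} \<in> E)"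

definition nbs :: "'a set set \<Rightarrow> 'a \<Rightarrow> 'a set" where
  "nbs E v = {w. {v, w} \<in> E}"

lemma near_symp: "symp (near E)"
  unfolding symp_def near_def by (metis insert_commute)

lemma near_irreflp: "irreflp (near E)"
  unfolding irreflp_def near_def by blast

lemma nbs_sym: "w \<in> nbs E v \<longleftrightarrow> v \<in> nbs E w"
  unfolding nbs_def by (simp add: insert_commute)

text \<open>Only edges are colored, so the vertex set is dropped and the hypotheses pass to subsets
  of \<open>E\<close>. \<open>A\<close> is one side of the bipartition; \<open>side\<close> also
  excludes the loops that \<open>edgeE\<close> would admit.\<close>

locale sparse_bipartite =
  fixes E :: "'a set set" and A :: "'a set"
  assumes fin: "finite E"
    and edgeE: "e \<in> E \<Longrightarrow> \<exists>u v. e = {u, v}"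
    and side: "{u, v} \<in> E \<Longrightarrow> u \<in> A \<longleftrightarrow> v \<notin> A"
    and deg3: "degree E v \<le> 3"
    and deg5: "{u, v} \<in> E \<Longrightarrow> degree E u + degree E v \<le> 5"
begin

lemma finite_nbs: "finite (nbs E v)"
proof (rule finite_subset)
  show "nbs E v \<subseteq> \<Union>E" unfolding nbs_def by auto
  show "finite (\<Union>E)" using fin edgeE by (metis finite.emptyI finite.insertI finite_Union)
qed

lemma edge_at:
  assumes "e \<in> E" "a \<in> e"
  obtains b where "e = {a, b}" "b \<in> nbs E a"
proof -
  obtain u v where "e = {u, v}" using edgeE[OF assms(1)] by blast
  then show thesis
    using that[of u] that[of v] assms unfolding nbs_def by (auto simp: insert_commute)
qed

lemma degree_nbs: "degree E v = card (nbs E v)"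
proof -
  have "{e \<in> E. v \<in> e} = (\<lambda>w. {v, w}) ` nbs E v"
    by (auto elim!: edge_at) (auto simp: nbs_def)
  moreover have "inj_on (\<lambda>w. {v, w}) (nbs E v)"
    by (auto simp: inj_on_def doubleton_eq_iff)
  ultimately show ?thesis unfolding degree_def by (simp add: card_image)
qed

section \<open>Counting the edges near a given edge\<close>

lemma near_touch:
  assumes "e \<in> E" "f \<in> E" "e \<noteq> f" "e \<inter> f \<noteq> {}"
  shows "near E e f"
proof -
  obtain a where a: "a \<in> e" "a \<in> f" using assms(4) by blast
  obtain b where "e = {b, a}" using edge_at[OF assms(1) a(1)] by (metis insert_commute)
  then show ?thesis unfolding near_def using assms a by blast
qed

lemma near_touch2:
  assumes "e \<in> E" "f \<in> E" "g \<in> E" "e \<noteq> g" "e \<inter> f \<noteq> {}" "f \<inter> g \<noteq> {}"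
  shows "near E e g"
proof (cases "e \<inter> g = {}")
  case True
  obtain a b where ab: "a \<in> e" "a \<in> f" "b \<in> f" "b \<in> g" using assms by blast
  with True have "a \<noteq> b" by blast
  with ab edgeE[OF assms(2)] have "f = {a, b}" by auto
  then show ?thesis unfolding near_def using assms ab by blast
qed (use assms near_touch in auto)

text \<open>A near edge contains a neighbor \<open>y\<close> of \<open>u\<close> or of
  \<open>v\<close>. If \<open>y\<close> is the other end of \<open>{u, v}\<close>, the second vertex
  of the near edge is a neighbor of that end instead. The stars give the degree bound, and in
  concrete configurations they list the near edges explicitly.\<close>

lemma near_stars:
  assumes "{u, v} \<in> E"
  shows "{f. near E {u, v} f} \<subseteq> (\<Union>w\<in>nbs E u - {v}. (\<lambda>x. {w, x}) ` nbs E w)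
    \<union> (\<Union>w\<in>nbs E v - {u}. (\<lambda>x. {w, x}) ` nbs E w)"
proof
  fix f assume "f \<in> {f. near E {u, v} f}"
  then obtain x y where f: "f \<in> E" "f \<noteq> {u, v}" "x \<in> {u, v}" "y \<in> f" "{x, y} \<in> E"
    unfolding near_def by blast
  obtain z where z: "f = {y, z}" using edgeE[OF f(1)] f(4) by blast
  have star: "f \<in> (\<lambda>x. {w, x}) ` nbs E w" if "w \<in> f" for w
    using that z f(1) unfolding nbs_def by (auto simp: insert_commute)
  have z': "z \<in> nbs E y" using f(1) z unfolding nbs_def by auto
  from f(3,5) consider "x = u" "y \<in> nbs E u" | "x = v" "y \<in> nbs E v" unfolding nbs_def by blast
  then show "f \<in> (\<Union>w\<in>nbs E u - {v}. (\<lambda>x. {w, x}) ` nbs E w)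
    \<union> (\<Union>w\<in>nbs E v - {u}. (\<lambda>x. {w, x}) ` nbs E w)"
  proof cases
    case 1
    show ?thesis
    proof (cases "y = v")
      case True
      then have "z \<in> nbs E v - {u}" using f(2) z z' by (auto simp: insert_commute)
      then show ?thesis using star[of z] z by blast
    next
      case False
      then show ?thesis using 1(2) star[of y] z by blast
    qed
  next
    case 2
    show ?thesis
    proof (cases "y = u")
      case True
      then have "z \<in> nbs E u - {v}" using f(2) z z' by auto
      then show ?thesis using star[of z] z by blast
    next
      case False
      then show ?thesis using 2(2) star[of y] z by blast
    qed
  qed
qed

lemma finite_near: "finite {f. near E e f}"
  by (rule finite_subset[OF _ fin]) (auto simp: near_def)

lemma card_near:
  assumes "{u, v} \<in> E"
  shows "card {f. near E {u, v} f}
    \<le> (\<Sum>w\<in>nbs E u - {v}. degree E w) + (\<Sum>w\<in>nbs E v - {u}. degree E w)"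
proof -
  have half: "card (\<Union>w\<in>nbs E u - {v}. (\<lambda>x. {w, x}) ` nbs E w) \<le> (\<Sum>w\<in>nbs E u - {v}. degree E w)" for u v
  proof -
    have "card (\<Union>w\<in>nbs E u - {v}. (\<lambda>x. {w, x}) ` nbs E w)
      \<le> (\<Sum>w\<in>nbs E u - {v}. card ((\<lambda>x. {w, x}) ` nbs E w))"
      using finite_nbs by (intro card_UN_le) auto
    also have "\<dots> \<le> (\<Sum>w\<in>nbs E u - {v}. degree E w)"
      using card_image_le[OF finite_nbs] by (intro sum_mono) (auto simp: degree_nbs)
    finally show ?thesis .
  qed
  have "card {f. near E {u, v} f} \<le> card ((\<Union>w\<in>nbs E u - {v}. (\<lambda>x. {w, x}) ` nbs E w)
    \<union> (\<Union>w\<in>nbs E v - {u}. (\<lambda>x. {w, x}) ` nbs E w))"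
    by (rule card_mono[OF _ near_stars[OF assms]]) (auto simp: finite_nbs)
  also have "\<dots> \<le> card (\<Union>w\<in>nbs E u - {v}. (\<lambda>x. {w, x}) ` nbs E w)
    + card (\<Union>w\<in>nbs E v - {u}. (\<lambda>x. {w, x}) ` nbs E w)" by (rule card_Un_le)
  finally show ?thesis using half[of u v] half[of v u] by linarith
qed

lemma sum_nbs_le:
  assumes "{u, v} \<in> E"
  shows "(\<Sum>w\<in>nbs E u - {v}. degree E w) \<le> (degree E u - 1) * min 3 (5 - degree E u)"
proof -
  have "(\<Sum>w\<in>nbs E u - {v}. degree E w) \<le> card (nbs E u - {v}) * min 3 (5 - degree E u)"
  proof (rule sum_bounded_above[of _ _ "min 3 (5 - degree E u)", simplified])
    fix w assume "w \<in> nbs E u - {v}"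
    then have "{u, w} \<in> E" unfolding nbs_def by auto
    then show "degree E w \<le> 3 \<and> degree E w \<le> 5 - degree E u" using deg3 deg5 by fastforce
  qed
  moreover have "v \<in> nbs E u" using assms unfolding nbs_def by auto
  ultimately show ?thesis using finite_nbs by (simp add: degree_nbs)
qed

lemma degree_pos: "{u, v} \<in> E \<Longrightarrow> degree E u \<ge> 1 \<and> degree E v \<ge> 1"
  using finite_nbs unfolding degree_nbs nbs_def
  by (metis (mono_tags, lifting) One_nat_def Suc_leI card_gt_0_iff empty_iff insert_commute mem_Collect_eq)

text \<open>For degrees 1, 2, 3 of \<open>u\<close> the bound of \<open>sum_nbs_le\<close> takes the
  values 0, 3, 4.\<close>

lemma sum_nbs:
  assumes "{u, v} \<in> E"
  shows "(\<Sum>w\<in>nbs E u - {v}. degree E w) \<le> 4"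
    and "degree E u \<le> 2 \<Longrightarrow> (\<Sum>w\<in>nbs E u - {v}. degree E w) \<le> 3"
proof -
  consider "degree E u = 1" | "degree E u = 2" | "degree E u = 3"
    using degree_pos[OF assms] deg3[of u] by linarith
  then have "(\<Sum>w\<in>nbs E u - {v}. degree E w) \<le> 4 \<and> (degree E u \<le> 2 \<longrightarrow> (\<Sum>w\<in>nbs E u - {v}. degree E w) \<le> 3)"
    using sum_nbs_le[OF assms] by cases simp_all
  then show "(\<Sum>w\<in>nbs E u - {v}. degree E w) \<le> 4"
    and "degree E u \<le> 2 \<Longrightarrow> (\<Sum>w\<in>nbs E u - {v}. degree E w) \<le> 3" by auto
qed

text \<open>The degree sum forces one end to have degree at most 2. That end contributes at most 3
  near edges, the other at most 4.\<close>

lemma card_near_le_7: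
  assumes "e \<in> E"
  shows "card {f. near E e f} \<le> 7"
proof -
  obtain u v where e: "e = {u, v}" using edgeE[OF assms] by blast
  have uv: "{u, v} \<in> E" and vu: "{v, u} \<in> E" using assms e by (auto simp: insert_commute)
  have "degree E u \<le> 2 \<or> degree E v \<le> 2" using deg5[OF uv] by linarith
  then show ?thesis
    using card_near[OF uv] sum_nbs[OF uv] sum_nbs[OF vu] unfolding e by linarith
qed

lemma near_deg: "finite {f \<in> E. near E e f} \<and> card {f \<in> E. near E e f} \<le> 7" if "e \<in> E"
proof -
  have "{f \<in> E. near E e f} = {f. near E e f}" by (auto simp: near_def)
  then show ?thesis using that finite_near card_near_le_7 by auto
qed

section \<open>Naming the vertices around an edge\<close>

lemma nbs_2:
  assumes "{u, v} \<in> E" "degree E u = 2"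
  obtains w where "nbs E u = {v, w}" "w \<noteq> v"
proof -
  have "v \<in> nbs E u" using assms unfolding nbs_def by auto
  then show thesis using assms(2) that unfolding degree_nbs card_2_iff by (metis insertE insert_commute singletonD)
qed

lemma nbs_3:
  assumes "{u, v} \<in> E" "degree E u = 3"
  obtains w x where "nbs E u = {v, w, x}" "w \<noteq> v" "x \<noteq> v" "w \<noteq> x"
proof -
  have v: "v \<in> nbs E u" using assms unfolding nbs_def by auto
  then have "card (nbs E u - {v}) = 2" using assms(2) finite_nbs unfolding degree_nbs by simp
  then obtain w x where "nbs E u - {v} = {w, x}" "w \<noteq> x" unfolding card_2_iff by blast
  then show thesis using that[of w x] v by blast
qed

text \<open>Taking \<open>A\<close> or its complement as the class of \<open>u\<close> lets vertices
  of a configuration be told apart by the parity of their distance from \<open>u\<close>.\<close>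

lemma bipartition_side: "\<exists>C. u \<in> C \<and> (\<forall>x y. y \<in> nbs E x \<longrightarrow> (x \<in> C \<longleftrightarrow> y \<notin> C))"
proof (cases "u \<in> A")
  case True
  then show ?thesis using side unfolding nbs_def by (intro exI[of _ A]) blast
next
  case False
  then show ?thesis using side unfolding nbs_def by (intro exI[of _ "- A"]) blast
qed

lemma nbs_of_nbr:
  assumes "p \<in> nbs E x" "degree E x = 3" "degree E p \<noteq> 1"
  obtains p' where "nbs E p = {x, p'}" "p' \<noteq> x"
proof -
  have px: "{p, x} \<in> E" using assms(1) unfolding nbs_def by (simp add: insert_commute)
  then have "degree E p = 2" using deg5[OF px] degree_pos[OF px] assms(2,3) by linarith
  then show thesis using nbs_2[OF px] that by blast
qed

end

section \<open>Reducible configurations\<close>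

text \<open>Connectivity is phrased for edge sets: it supplies the next edge to the greedy coloring,
  and its failure is a splitting into two edge sets without common vertices.\<close>

locale connected_sparse_bipartite = sparse_bipartite +
  assumes conn: "S \<subseteq> E \<Longrightarrow> S \<noteq> {} \<Longrightarrow> S \<noteq> E \<Longrightarrow> \<exists>e\<in>E - S. \<exists>f\<in>S. e \<inter> f \<noteq> {}"
begin

text \<open>Induction on the number of edges outside \<open>S\<close>. An edge \<open>e\<close>
  touching some \<open>f\<close> in \<open>S\<close> is added to \<open>S\<close>, the rest is
  colored by induction, and \<open>e\<close> comes last. Then \<open>f\<close> and an edge
  \<open>g\<close> of \<open>S\<close> touching \<open>f\<close> are uncolored and near
  \<open>e\<close>, so at most 5 colors are forbidden. The enlarged set still has no isolated edge
  because \<open>e\<close> touches \<open>f\<close>.\<close>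

lemma greedy_outside:
  assumes "S \<subseteq> E" "S \<noteq> {}" "\<And>e. e \<in> S \<Longrightarrow> \<exists>f\<in>S. f \<noteq> e \<and> e \<inter> f \<noteq> {}"
  shows "\<exists>c. proper6 (near E) (E - S) c"
  using assms
proof (induction "card (E - S)" arbitrary: S rule: less_induct)
  case less
  show ?case
  proof (cases "S = E")
    case True
    then show ?thesis unfolding proper6_def by simp
  next
    case False
    obtain e f where e: "e \<in> E - S" and f: "f \<in> S" "e \<inter> f \<noteq> {}" using conn[OF less.prems(1,2) False] by blast
    obtain g where g: "g \<in> S" "g \<noteq> f" "f \<inter> g \<noteq> {}" using less.prems(3)[OF f(1)] by blast
    have "\<exists>c. proper6 (near E) (E - insert e S) c"
    proof (rule less.hyps)
      show "card (E - insert e S) < card (E - S)"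
        using e fin by (intro psubset_card_mono) auto
      show "insert e S \<subseteq> E" "insert e S \<noteq> {}" using e less.prems(1) by auto
      show "\<exists>f\<in>insert e S. f \<noteq> h \<and> h \<inter> f \<noteq> {}" if "h \<in> insert e S" for h
      proof (cases "h = e")
        case True
        then show ?thesis using e f by (intro bexI[of _ f]) auto
      next
        case False
        then show ?thesis using less.prems(3)[of h] that by blast
      qed
    qed
    then obtain c where c: "proper6 (near E) (E - insert e S) c" by blast
    have fg: "{f, g} \<subseteq> {x. near E e x}"
      using near_touch[of e f] near_touch2[of e f g] e f g less.prems(1) by auto
    have "card {x \<in> E - insert e S. near E e x} \<le> card ({x. near E e x} - {f, g})"
      using f g finite_near by (intro card_mono) auto
    also have "\<dots> \<le> 5"
      using card_near_le_7[of e] e fg g(2) by (subst card_Diff_subset) auto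
    finally obtain z where "z < 6" "z \<notin> c ` {x \<in> E - insert e S. near E e x}"
      using fin ex_free_color[of "{x \<in> E - insert e S. near E e x}" c] by auto
    then show ?thesis using proper6_update[OF near_symp near_irreflp c] by blast
  qed
qed

text \<open>All edges but these two are colored greedily. Then \<open>f\<close> is colored while
  \<open>e\<close> is still uncolored, so at most 5 of its 6 near edges count; finally
  \<open>e\<close> has at most 5 near edges at all.\<close>

lemma colorable_if_two_light_edges:
  assumes "e \<in> E" "f \<in> E" "e \<noteq> f" "e \<inter> f \<noteq> {}"
    and "card {x. near E e x} \<le> 5" "card {x. near E f x} \<le> 6"
  shows "\<exists>c. proper6 (near E) E c"
proof -
  have step: "\<exists>c. proper6 (near E) (E - S) c"
    if h: "proper6 (near E) (E - insert h S) c" "card ({x. near E h x} - S) \<le> 5" for h S c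
  proof -
    have "card {x \<in> E - insert h S. near E h x} \<le> card ({x. near E h x} - S)"
      using finite_near by (intro card_mono) auto
    then obtain z where "z < 6" "z \<notin> c ` {x \<in> E - insert h S. near E h x}"
      using fin h(2) ex_free_color[of "{x \<in> E - insert h S. near E h x}" c] by auto
    then show ?thesis using proper6_update[OF near_symp near_irreflp h(1)] by blast
  qed
  have ef: "near E f e" using near_touch[of f e] assms by auto
  obtain c where "proper6 (near E) (E - {f, e}) c"
    using greedy_outside[of "{f, e}"] assms by (auto simp: Int_commute)
  moreover have "card ({x. near E f x} - {e}) \<le> 5" using ef assms(6) by simp
  ultimately obtain c where "proper6 (near E) (E - {e}) c" using step[of f "{e}"] by blast
  then show ?thesis using step[of e "{}"] assms(5) by simp
qed

text \<open>Unless the graph is a single edge, the pendant edge and any other edge at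
  \<open>v\<close> are light: the first has nothing beyond \<open>a\<close>, and in the count for
  the second \<open>a\<close> contributes only 1.\<close>

lemma colorable_if_pendant:
  assumes "{a, v} \<in> E" "degree E a = 1"
  shows "\<exists>c. proper6 (near E) E c"
proof -
  have va: "{v, a} \<in> E" using assms by (simp add: insert_commute)
  have na: "nbs E a = {v}"
  proof -
    have "card (nbs E a) = 1" "v \<in> nbs E a" using assms by (simp_all add: degree_nbs nbs_def)
    then show ?thesis by (metis card_1_singletonE singletonD)
  qed
  have av: "a \<in> nbs E v" using va unfolding nbs_def by simp
  show ?thesis
  proof (cases "nbs E v = {a}")
    case True
    have "E = {{a, v}}"
    proof (rule ccontr)
      assume "E \<noteq> {{a, v}}"
      then obtain e where e: "e \<in> E - {{a, v}}" "e \<inter> {a, v} \<noteq> {}"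
        using conn[of "{{a, v}}"] assms by auto
      obtain x y where "e = {x, y}" using edgeE e by blast
      then have "x \<in> nbs E y" "y \<in> nbs E x" using e unfolding nbs_def by (auto simp: insert_commute)
      then show False using e \<open>e = {x, y}\<close> na True by auto
    qed
    then have "proper6 (near E) E (\<lambda>_. 0)" unfolding proper6_def near_def by auto
    then show ?thesis by blast
  next
    case False
    then obtain w where w: "w \<in> nbs E v" "w \<noteq> a" using av by blast
    then have vw: "{v, w} \<in> E" and wv: "{w, v} \<in> E" unfolding nbs_def by (auto simp: insert_commute)
    have "card {x. near E {a, v} x} \<le> 5"
      using card_near[OF assms(1)] sum_nbs(1)[OF va] na by simp
    moreover have "card {x. near E {v, w} x} \<le> 6"
    proof -
      have c: "card (nbs E v - {w} - {a}) = degree E v - 2"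
        using w av finite_nbs[of v] unfolding degree_nbs by simp
      have "(\<Sum>x\<in>nbs E v - {w}. degree E x) = degree E a + (\<Sum>x\<in>nbs E v - {w} - {a}. degree E x)"
        using av w finite_nbs by (intro sum.remove) auto
      also have "(\<Sum>x\<in>nbs E v - {w} - {a}. degree E x) \<le> (degree E v - 2) * (5 - degree E v)"
      proof (subst c[symmetric], rule sum_bounded_above[of _ _ "5 - degree E v", simplified])
        fix x assume "x \<in> nbs E v - {w} - {a}"
        then have "{v, x} \<in> E" unfolding nbs_def by auto
        then show "degree E x \<le> 5 - degree E v" using deg5[of v x] by linarith
      qed
      finally have s: "(\<Sum>x\<in>nbs E v - {w}. degree E x) \<le> 1 + (degree E v - 2) * (5 - degree E v)"
        using assms(2) by simp
      have "degree E v = 3 \<or> degree E v \<le> 2" using deg3[of v] by linarith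
      then show ?thesis
      proof
        assume d: "degree E v = 3"
        then have "degree E w \<le> 2" using deg5[OF vw] by simp
        then show ?thesis using d s card_near[OF vw] sum_nbs(2)[OF wv] by simp
      next
        assume d: "degree E v \<le> 2"
        then show ?thesis using s card_near[OF vw] sum_nbs(1)[OF wv] by simp
      qed
    qed
    ultimately show ?thesis
      using w by (intro colorable_if_two_light_edges[of "{a, v}" "{v, w}"]) (auto simp: assms vw doubleton_eq_iff)
  qed
qed

text \<open>In the count for either edge of the path, the middle vertex contributes only one
  neighbor, of degree 2, and the other end at most 3. Both edges thus have at most 5 near
  edges.\<close>

lemma colorable_if_three_path:
  assumes xu: "{x, u} \<in> E" and uv: "{u, v} \<in> E" and "x \<noteq> v" "degree E x = 2" "degree E u = 2" "degree E v = 2"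
  shows "\<exists>c. proper6 (near E) E c"
proof -
  have ux: "{u, x} \<in> E" and vu: "{v, u} \<in> E" using xu uv by (simp_all add: insert_commute)
  have nu: "nbs E u = {x, v}"
  proof -
    obtain w where "nbs E u = {v, w}" using nbs_2[OF uv] assms by metis
    moreover have "x \<in> nbs E u" using ux unfolding nbs_def by simp
    ultimately show ?thesis using assms(3) by auto
  qed
  have s: "nbs E u - {v} = {x}" "nbs E u - {x} = {v}" using nu assms(3) by auto
  have "card {f. near E {u, v} f} \<le> 5" "card {f. near E {x, u} f} \<le> 6"
    using card_near[OF uv] card_near[OF xu] sum_nbs(2)[OF vu] sum_nbs(2)[OF xu] assms unfolding s by simp_all
  then show ?thesis
    using assms(3) by (intro colorable_if_two_light_edges[of "{u, v}" "{x, u}"]) (auto simp: xu uv doubleton_eq_iff)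
qed

text \<open>If a further neighbor has degree 2, there is a path of three such vertices. Otherwise
  \<open>x\<close> and \<open>y\<close> have degree 3 and all their neighbors have degree 2, and the
  path \<open>x\<close>, \<open>u\<close>, \<open>v\<close>, \<open>y\<close> is colored last by
  \<open>proper6_extend_triangle\<close>.\<close>

lemma colorable_if_adjacent_degree_2:
  assumes min: "\<And>w. degree E w \<noteq> 1"
    and uv: "{u, v} \<in> E" and d: "degree E u = 2" "degree E v = 2"
  shows "\<exists>c. proper6 (near E) E c"
proof -
  have vu: "{v, u} \<in> E" using uv by (simp add: insert_commute)
  obtain x where nu: "nbs E u = {v, x}" "x \<noteq> v" using nbs_2[OF uv d(1)] .
  obtain y where nv: "nbs E v = {u, y}" "y \<noteq> u" using nbs_2[OF vu d(2)] .
  have ux: "{u, x} \<in> E" and vy: "{v, y} \<in> E" using nu nv unfolding nbs_def by blast+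
  have xu: "{x, u} \<in> E" and yv: "{y, v} \<in> E" using ux vy by (simp_all add: insert_commute)
  have cases: "degree E w = 2 \<or> degree E w = 3" if "{w, z} \<in> E" for w z
    using min[of w] deg3[of w] degree_pos[OF that] by linarith
  consider "degree E x = 2" | "degree E y = 2" | "degree E x = 3" "degree E y = 3"
    using cases[OF xu] cases[OF yv] by blast
  then show ?thesis
  proof cases
    case 1
    show ?thesis using colorable_if_three_path[OF xu uv nu(2) 1 d] .
  next
    case 2
    show ?thesis using colorable_if_three_path[OF yv vu nv(2) 2 d(2,1)] .
  next
    case 3
    obtain p q where nx: "nbs E x = {u, p, q}" "p \<noteq> u" "q \<noteq> u" "p \<noteq> q" using nbs_3[OF xu 3(1)] .
    obtain h k where ny: "nbs E y = {v, h, k}" "h \<noteq> v" "k \<noteq> v" "h \<noteq> k" using nbs_3[OF yv 3(2)] .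
    obtain p' where np: "nbs E p = {x, p'}" "p' \<noteq> x" using nbs_of_nbr[of p x] nx(1) 3(1) min by blast
    obtain q' where nq: "nbs E q = {x, q'}" "q' \<noteq> x" using nbs_of_nbr[of q x] nx(1) 3(1) min by blast
    obtain h' where nh: "nbs E h = {y, h'}" "h' \<noteq> y" using nbs_of_nbr[of h y] ny(1) 3(2) min by blast
    obtain k' where nk: "nbs E k = {y, k'}" "k' \<noteq> y" using nbs_of_nbr[of k y] ny(1) 3(2) min by blast
    have E: "{x, p} \<in> E" "{x, q} \<in> E" "{y, h} \<in> E" "{y, k} \<in> E"
      "{p, p'} \<in> E" "{q, q'} \<in> E" "{h, h'} \<in> E" "{k, k'} \<in> E"
      using nx(1) ny(1) np(1) nq(1) nh(1) nk(1) unfolding nbs_def by blast+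
    obtain C where "u \<in> C" and C: "\<And>x y. y \<in> nbs E x \<Longrightarrow> x \<in> C \<longleftrightarrow> y \<notin> C" using bipartition_side[of u] by blast
    then have v: "v \<notin> C" "x \<notin> C" and "y \<in> C" "p \<in> C" "q \<in> C"
      using nu(1) nv(1) nx(1) C[of v u] C[of x u] C[of y v] C[of p x] C[of q x] by auto
    with \<open>u \<in> C\<close> have even: "{u, y, p, q} \<subseteq> C" by auto
    have "h \<notin> C" "k \<notin> C" "p' \<notin> C" "q' \<notin> C"
      using even ny(1) np(1) nq(1) C[of h y] C[of k y] C[of p' p] C[of q' q] by auto
    with v have odd: "{v, x, h, k, p', q'} \<inter> C = {}" by auto
    have "card (nbs E y) = 3" "card (nbs E p) \<noteq> 3" "card (nbs E q) \<noteq> 3"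
      "card (nbs E x) = 3" "card (nbs E h) \<noteq> 3" "card (nbs E k) \<noteq> 3"
      using 3 np nq nh nk by (simp_all add: degree_nbs)
    then have ne1: "y \<noteq> p" "y \<noteq> q" "x \<noteq> h" "x \<noteq> k" by blast+
    have ne2: "\<forall>a\<in>{u, y, p, q}. \<forall>b\<in>{v, x, h, k, p', q'}. a \<noteq> b \<and> b \<noteq> a"
      using even odd by blast
    note ne = ne1 ne1[symmetric] ne2[simplified] nu(2) nu(2)[symmetric] nv(2) nv(2)[symmetric] nx(2-4)
      nx(2-4)[symmetric] ny(2-4) ny(2-4)[symmetric] np(2) np(2)[symmetric] nq(2) nq(2)[symmetric]
      nh(2) nh(2)[symmetric] nk(2) nk(2)[symmetric]
    let ?s1 = "{u, x}" and ?s2 = "{u, v}" and ?s3 = "{v, y}"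
    let ?S = "{?s1, ?s2, ?s3}"
    let ?X1 = "{{x, p}, {x, q}, {p, p'}, {q, q'}}"
    let ?X2 = "{{x, p}, {x, q}, {y, h}, {y, k}}"
    let ?X3 = "{{y, h}, {y, k}, {h, h'}, {k, k'}}"
    have dist: "distinct [?s1, ?s2, ?s3]" by (simp add: doubleton_eq_iff ne)
    have N: "{f. near E ?s1 f} \<subseteq> ?S \<union> ?X1" "{f. near E ?s2 f} \<subseteq> ?S \<union> ?X2" "{f. near E ?s3 f} \<subseteq> ?S \<union> ?X3"
      by (rule subset_trans[OF near_stars[OF ux]] subset_trans[OF near_stars[OF uv]]
          subset_trans[OF near_stars[OF vy]],
        simp add: nu(1) nv(1) nx(1) ny(1) np(1) nq(1) nh(1) nk(1) insert_Diff_if ne doubleton_eq_iff)+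
    \<comment> \<open>Only an upper bound: the edges listed in one set are not shown to be
      distinct.\<close>
    have c4: "card {a, b, c, d} \<le> 4" for a b c d :: "'a set"
      using card_length[of "[a, b, c, d]"] by simp
    have XE: "?X1 \<subseteq> E - ?S" "?X2 \<subseteq> E - ?S" "?X3 \<subseteq> E - ?S"
      using E by (simp_all add: doubleton_eq_iff ne)
    have fin: "?thesis" if "proper6 (near E) (E - ?S) c"
      "\<not> (c ` ?X1 = c ` ?X2 \<and> c ` ?X2 = c ` ?X3 \<and> card (c ` ?X1) = 4)" for c
      by (rule proper6_extend_triangle[OF near_symp near_irreflp that(1) dist N _ _ _ c4 c4 c4 XE that(2)]) simp_all
    have "\<exists>c. proper6 (near E) (E - ?S) c"
    proof (rule greedy_outside)
      show "?S \<subseteq> E" using ux uv vy by simp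
      show "\<exists>f\<in>?S. f \<noteq> e \<and> e \<inter> f \<noteq> {}" if "e \<in> ?S" for e
        using that by (elim insertE emptyE) (simp_all add: doubleton_eq_iff ne)
    qed simp
    then obtain c where c: "proper6 (near E) (E - ?S) c" by blast
    \<comment> \<open>The colors common to both sets can be cancelled because four colors on four
      edges are pairwise different. In the bad case this equates the color pair of the edges from
      \<open>x\<close> to \<open>p\<close>, \<open>q\<close> with that of \<open>{h, h'}\<close>,
      \<open>{k, k'}\<close>.\<close>
    have four: "{a, b} = {m, n} \<and> {a, b} \<inter> {h, k} = {}"
      if "{a, b, h, k} = {h, k, m, n}" "card {a, b, h, k} = 4" for a b h k m n :: nat
    proof -
      have "distinct [a, b, h, k]" using that(2) card_distinct[of "[a, b, h, k]"] by simp
      moreover have "distinct [h, k, m, n]" using that card_distinct[of "[h, k, m, n]"] by simp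
      ultimately show ?thesis using that(1) by auto
    qed
    have pairs: "{d {x, p}, d {x, q}} = {d {h, h'}, d {k, k'}}"
      if "d ` ?X1 = d ` ?X2 \<and> d ` ?X2 = d ` ?X3 \<and> card (d ` ?X1) = 4" for d :: "'a set \<Rightarrow> nat"
    proof -
      have "d ` ?X2 = d ` ?X3" using that by (elim conjE)
      moreover have "card (d ` ?X2) = 4" using that by (elim conjE) (simp only:)
      ultimately show ?thesis unfolding image_insert image_empty by (metis (no_types) four)
    qed
    show ?thesis
    proof (cases "c ` ?X1 = c ` ?X2 \<and> c ` ?X2 = c ` ?X3 \<and> card (c ` ?X1) = 4")
      case True
      have eq: "{c {x, p}, c {x, q}} = {c {h, h'}, c {k, k'}}" using pairs[OF True] .
      have adj: "near E {x, p} {x, q}" "near E {x, p} {p, p'}" "near E {x, q} {p, p'}"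
        "near E {x, p} ?s1" "near E {x, p} ?s2" "near E {x, q} ?s1" "near E {x, q} ?s2" "near E {p, p'} ?s1"
        using E ux uv by (auto intro: near_touch near_touch2[of _ "{x, p}"] near_touch2[of _ "{u, x}"]
          simp: doubleton_eq_iff ne)
      obtain c' where c': "proper6 (near E) (E - ?S) c'"
        "\<And>e. e \<notin> {{x, p}, {x, q}, {p, p'}} \<Longrightarrow> c' e = c e" "{c' {x, p}, c' {x, q}} \<noteq> {c {x, p}, c {x, q}}"
        by (rule recolor_pair[OF near_symp near_irreflp c near_deg _ _ _ _ _ ux uv _ adj]) (use XE dist in auto)
      \<comment> \<open>Recoloring may also change \<open>{p, p'}\<close>, which might a priori be
        one of the edges beyond \<open>y\<close>. Its color differs from the common pair, so it is
        not, and the edges beyond \<open>y\<close> keep their colors while the pair at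
        \<open>x\<close> changes.\<close>
      have pp: "c {p, p'} \<notin> {c {x, p}, c {x, q}}"
        using proper6_neq[OF c adj(2)] proper6_neq[OF c adj(3)] XE(1) by simp
      then have "{h, h'} \<noteq> {p, p'}" "{k, k'} \<noteq> {p, p'}" using eq by auto
      then have same: "c' {y, h} = c {y, h}" "c' {y, k} = c {y, k}" "c' {h, h'} = c {h, h'}" "c' {k, k'} = c {k, k'}"
        by (intro c'(2); simp add: doubleton_eq_iff ne)+
      show ?thesis
      proof (rule fin[OF c'(1)], rule notI)
        assume *: "c' ` ?X1 = c' ` ?X2 \<and> c' ` ?X2 = c' ` ?X3 \<and> card (c' ` ?X1) = 4"
        show False using pairs[OF *] c'(3) eq same by simp
      qed
    next
      case False
      show ?thesis by (rule fin[OF c False])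
    qed
  qed
qed

text \<open>The 4-cycle runs through \<open>r\<close>, \<open>a1\<close>, \<open>b\<close>,
  \<open>a2\<close>. If its two leaving edges end in the same vertex, two light edges exist;
  otherwise the cycle and the leaving edges are colored last.\<close>

lemma colorable_if_square:
  assumes all32: "\<And>u v. {u, v} \<in> E \<Longrightarrow> degree E u = 2 \<and> degree E v = 3 \<or> degree E u = 3 \<and> degree E v = 2"
    and nr: "nbs E r = {a1, a2, a3}" "a1 \<noteq> a2" "a1 \<noteq> a3" "a2 \<noteq> a3"
    and na: "nbs E a1 = {r, b}" "nbs E a2 = {r, b}" "b \<noteq> r"
  shows "\<exists>c. proper6 (near E) E c"
proof -
  have E1: "{r, a1} \<in> E" "{r, a2} \<in> E" "{r, a3} \<in> E" "{a1, b} \<in> E" "{a2, b} \<in> E"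
    using nr(1) na(1,2) unfolding nbs_def by blast+
  have E2: "{b, a1} \<in> E" "{a3, r} \<in> E" using E1 by (simp_all add: insert_commute)
  have "degree E a1 = 2" using na(1,3) by (simp add: degree_nbs)
  then have db: "degree E b = 3" using all32[OF E1(4)] by simp
  have dr: "degree E r = 3" using nr by (simp add: degree_nbs)
  have a2b: "a2 \<in> nbs E b" using E1(5) unfolding nbs_def by (simp add: insert_commute)
  obtain a' where nb: "nbs E b = {a1, a2, a'}" "a' \<noteq> a1" "a' \<noteq> a2"
  proof -
    obtain w x where "nbs E b = {a1, w, x}" "w \<noteq> a1" "x \<noteq> a1" "w \<noteq> x" using nbs_3[OF E2(1) db] .
    then show thesis using that[of w] that[of x] a2b nr(2) by auto
  qed
  obtain b3 where na3: "nbs E a3 = {r, b3}" "b3 \<noteq> r" using nbs_2[OF E2(2)] all32[OF E2(2)] dr by auto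
  obtain b' where na': "nbs E a' = {b, b'}" "b' \<noteq> b" using nbs_of_nbr[of a' b] all32 nb(1) db
    by (metis E1(4) degree_nbs insertCI mem_Collect_eq nbs_def numeral_eq_one_iff num.distinct(1,3))
  obtain C where "r \<in> C" and C: "\<And>x y. y \<in> nbs E x \<Longrightarrow> x \<in> C \<longleftrightarrow> y \<notin> C"
    using bipartition_side[of r] by blast
  then have a: "a1 \<notin> C" "a2 \<notin> C" "a3 \<notin> C" and "b \<in> C" "b3 \<in> C" "a' \<notin> C"
    using nr(1) na(1) nb(1) na3(1) C[of a1 r] C[of a2 r] C[of a3 r] C[of b a1] C[of b3 a3] C[of a' b] by auto
  then have "b' \<in> C" using C[of b' a'] na'(1) by auto
  have side: "\<forall>x\<in>{r, b, b3, b'}. \<forall>y\<in>{a1, a2, a3, a'}. x \<noteq> y \<and> y \<noteq> x"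
    using a \<open>r \<in> C\<close> \<open>b \<in> C\<close> \<open>b3 \<in> C\<close> \<open>a' \<notin> C\<close> \<open>b' \<in> C\<close> by blast
  note ne = side[simplified] nr(2-4) nr(2-4)[symmetric] na(3) na(3)[symmetric] nb(2,3) nb(2,3)[symmetric]
    na3(2) na3(2)[symmetric] na'(2) na'(2)[symmetric]
  show ?thesis
  proof (cases "a' = a3")
    \<comment> \<open>The edges at \<open>r\<close> and \<open>b\<close> now form a complete
      bipartite graph on 2 and 3 vertices, so an edge at \<open>r\<close> is near only the five
      others.\<close>
    case True
    have N: "{f. near E {r, a1} f} \<subseteq> {{r, a2}, {r, a3}, {a1, b}, {a2, b}, {a3, b}}"
      "{f. near E {r, a2} f} \<subseteq> {{r, a1}, {r, a3}, {a1, b}, {a2, b}, {a3, b}}"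
    proof -
      have "b3 = b" using True na3 na' ne by auto
      then show "{f. near E {r, a1} f} \<subseteq> {{r, a2}, {r, a3}, {a1, b}, {a2, b}, {a3, b}}"
        "{f. near E {r, a2} f} \<subseteq> {{r, a1}, {r, a3}, {a1, b}, {a2, b}, {a3, b}}"
        using True
        by - (rule subset_trans[OF near_stars[OF E1(1)]] subset_trans[OF near_stars[OF E1(2)]],
          simp add: nr(1) na(1,2) nb(1) na3(1) insert_Diff_if ne doubleton_eq_iff)+
    qed
    have five: "card X \<le> 5" if "X \<subseteq> {a, b, c, d, e}" for X and a b c d e :: "'a set"
      using card_mono[OF _ that] card_length[of "[a, b, c, d, e]"] by simp
    show ?thesis
      using five[OF N(1)] five[OF N(2)] E1(1,2) nr(2)
      by (intro colorable_if_two_light_edges[of "{r, a1}" "{r, a2}"]) (auto simp: doubleton_eq_iff)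
  next
    case False
    have b3b: "b3 \<noteq> b"
    proof
      assume "b3 = b"
      then have "a3 \<in> nbs E b" using na3(1) nbs_sym[of a3 E b] by simp
      then show False using nb(1) nr False by auto
    qed
    have b'r: "b' \<noteq> r"
    proof
      assume "b' = r"
      then have "a' \<in> nbs E r" using na'(1) nbs_sym[of a' E r] by simp
      then show False using nr(1) nb False by auto
    qed
    note ne = ne False False[symmetric] b3b b3b[symmetric] b'r b'r[symmetric]
    have E3: "{a3, b3} \<in> E" "{b, a'} \<in> E" "{a', b'} \<in> E" "{b3, a3} \<in> E" "{b', a'} \<in> E"
      using nb(1) na3(1) na'(1) unfolding nbs_def by (blast, blast, blast, auto simp: insert_commute)
    have "degree E a3 = 2" "degree E a' = 2"
      using na3(1) na'(1) ne by (simp_all add: degree_nbs)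
    then have d3: "degree E b3 = 3" "degree E b' = 3"
      using all32[OF E3(1)] all32[OF E3(3)] by simp_all
    obtain g h where nb3: "nbs E b3 = {a3, g, h}" using nbs_3[OF E3(4) d3(1)] by metis
    obtain g' h' where nb': "nbs E b' = {a', g', h'}" using nbs_3[OF E3(5) d3(2)] by metis
    let ?S = "{{r, a1}, {r, a2}, {a1, b}, {a2, b}, {r, a3}, {b, a'}}"
    have dist: "distinct [{r, a1}, {r, a2}, {a1, b}, {a2, b}, {r, a3}, {b, a'}]"
      by (simp add: doubleton_eq_iff ne)
    have N: "{f. near E {r, a1} f} \<subseteq> ?S \<union> {{a3, b3}}" "{f. near E {r, a2} f} \<subseteq> ?S \<union> {{a3, b3}}"
        "{f. near E {a1, b} f} \<subseteq> ?S \<union> {{a', b'}}" "{f. near E {a2, b} f} \<subseteq> ?S \<union> {{a', b'}}"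
        "{f. near E {r, a3} f} \<subseteq> ?S \<union> insert {a3, b3} {{b3, g}, {b3, h}}"
        "{f. near E {b, a'} f} \<subseteq> ?S \<union> insert {a', b'} {{b', g'}, {b', h'}}"
      by (rule subset_trans[OF near_stars[OF E1(1)]] subset_trans[OF near_stars[OF E1(2)]]
          subset_trans[OF near_stars[OF E1(4)]] subset_trans[OF near_stars[OF E1(5)]]
          subset_trans[OF near_stars[OF E1(3)]] subset_trans[OF near_stars[OF E3(2)]],
          simp add: nr(1) na(1,2) nb(1) na3(1) na'(1) nb3 nb' insert_Diff_if ne doubleton_eq_iff)+
    have "\<exists>c. proper6 (near E) (E - ?S) c"
    proof (rule greedy_outside)
      show "?S \<subseteq> E" using E1 E3 by simp
      show "\<exists>f\<in>?S. f \<noteq> e \<and> e \<inter> f \<noteq> {}" if "e \<in> ?S" for e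
        using that by (elim insertE emptyE) (simp_all add: doubleton_eq_iff ne)
    qed simp
    then obtain c where c: "proper6 (near E) (E - ?S) c" by blast
    \<comment> \<open>The two leaving edges may share a color: \<open>r\<close> and \<open>b\<close>
      lie on the same side, as do \<open>a3\<close> and \<open>a'\<close>, and a cross edge would
      make \<open>a'\<close> equal to \<open>a3\<close>.\<close>
    have "\<not> near E {r, a3} {b, a'}"
    proof
      assume "near E {r, a3} {b, a'}"
      then have "b \<in> nbs E r \<or> b \<in> nbs E a3 \<or> a' \<in> nbs E r \<or> a' \<in> nbs E a3"
        unfolding near_def nbs_def by auto
      then show False using nr(1) na3(1) by (simp add: ne)
    qed
    then show ?thesis
      using E3 by (intro proper6_extend_square[OF near_symp near_irreflp refl dist c N])
        (simp_all add: card_insert_if doubleton_eq_iff ne)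
  qed
qed

text \<open>The six edges around \<open>r\<close> are colored last. This can fail only if the pairs
  of further edges at \<open>b1\<close>, \<open>b2\<close>, \<open>b3\<close> carry the same colors;
  recoloring the pair at \<open>b1\<close> then separates it from the one at
  \<open>b2\<close>.\<close>

lemma colorable_if_no_square:
  assumes all32: "\<And>u v. {u, v} \<in> E \<Longrightarrow> degree E u = 2 \<and> degree E v = 3 \<or> degree E u = 3 \<and> degree E v = 2"
    and nr: "nbs E r = {a1, a2, a3}" "a1 \<noteq> a2" "a1 \<noteq> a3" "a2 \<noteq> a3"
    and na: "nbs E a1 = {r, b1}" "nbs E a2 = {r, b2}" "nbs E a3 = {r, b3}" "b1 \<noteq> r" "b2 \<noteq> r" "b3 \<noteq> r"
    and b: "b1 \<noteq> b2" "b1 \<noteq> b3" "b2 \<noteq> b3"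
  shows "\<exists>c. proper6 (near E) E c"
proof -
  have E1: "{r, a1} \<in> E" "{r, a2} \<in> E" "{r, a3} \<in> E" "{a1, b1} \<in> E" "{a2, b2} \<in> E" "{a3, b3} \<in> E"
    using nr(1) na(1-3) unfolding nbs_def by blast+
  have around: "\<exists>u v u' v'. nbs E b = {a, u, v} \<and> u \<noteq> a \<and> v \<noteq> a \<and> u \<noteq> v \<and>
      nbs E u = {b, u'} \<and> u' \<noteq> b \<and> nbs E v = {b, v'} \<and> v' \<noteq> b"
    if "{a, b} \<in> E" "nbs E a = {r, b}" "b \<noteq> r" for a b
  proof -
    have ba: "{b, a} \<in> E" using that(1) by (simp add: insert_commute)
    have "degree E a = 2" using that(2,3) by (simp add: degree_nbs)
    then have d: "degree E b = 3" using all32[OF that(1)] by simp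
    obtain u v where nb: "nbs E b = {a, u, v}" "u \<noteq> a" "v \<noteq> a" "u \<noteq> v" using nbs_3[OF ba d] .
    then have "{b, u} \<in> E" "{b, v} \<in> E" unfolding nbs_def by blast+
    then have "degree E u \<noteq> 1" "degree E v \<noteq> 1" using all32[of b u] all32[of b v] d by auto
    then obtain u' v' where "nbs E u = {b, u'}" "u' \<noteq> b" "nbs E v = {b, v'}" "v' \<noteq> b"
      using nbs_of_nbr[of u b] nbs_of_nbr[of v b] nb(1) d by (metis insertCI)
    then show ?thesis using nb by blast
  qed
  obtain u1 v1 u1' v1' where nb1: "nbs E b1 = {a1, u1, v1}" "u1 \<noteq> a1" "v1 \<noteq> a1" "u1 \<noteq> v1"
    "nbs E u1 = {b1, u1'}" "nbs E v1 = {b1, v1'}" "u1' \<noteq> b1" "v1' \<noteq> b1"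
    using around[OF E1(4) na(1,4)] by blast
  obtain u2 v2 u2' v2' where nb2: "nbs E b2 = {a2, u2, v2}" "u2 \<noteq> a2" "v2 \<noteq> a2" "u2 \<noteq> v2"
    "nbs E u2 = {b2, u2'}" "nbs E v2 = {b2, v2'}" "u2' \<noteq> b2" "v2' \<noteq> b2"
    using around[OF E1(5) na(2,5)] by blast
  obtain u3 v3 u3' v3' where nb3: "nbs E b3 = {a3, u3, v3}" "u3 \<noteq> a3" "v3 \<noteq> a3" "u3 \<noteq> v3"
    "nbs E u3 = {b3, u3'}" "nbs E v3 = {b3, v3'}" "u3' \<noteq> b3" "v3' \<noteq> b3"
    using around[OF E1(6) na(3,6)] by blast
  have E2: "{b1, u1} \<in> E" "{b1, v1} \<in> E" "{b2, u2} \<in> E" "{b2, v2} \<in> E" "{b3, u3} \<in> E" "{b3, v3} \<in> E"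
    "{u1, u1'} \<in> E"
    using nb1(1,5) nb2(1) nb3(1) unfolding nbs_def by blast+
  obtain C where rC: "r \<in> C" and C: "\<And>x y. y \<in> nbs E x \<Longrightarrow> x \<in> C \<longleftrightarrow> y \<notin> C"
    using bipartition_side[of r] by blast
  have aC: "a1 \<notin> C" "a2 \<notin> C" "a3 \<notin> C"
    using rC nr(1) C[of _ r] by auto
  have bC: "b1 \<in> C" "b2 \<in> C" "b3 \<in> C"
    using aC na(1-3) C[of b1 a1] C[of b2 a2] C[of b3 a3] by auto
  have uC: "u1 \<notin> C" "v1 \<notin> C" "u2 \<notin> C" "v2 \<notin> C" "u3 \<notin> C" "v3 \<notin> C"
    using bC nb1(1) nb2(1) nb3(1) C[of _ b1] C[of _ b2] C[of _ b3] by auto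
  have uC': "u1' \<in> C" using uC nb1(5) C[of u1' u1] by auto
  have side: "\<forall>x\<in>{r, b1, b2, b3, u1'}. \<forall>y\<in>{a1, a2, a3, u1, v1, u2, v2, u3, v3}. x \<noteq> y \<and> y \<noteq> x"
    using rC aC bC uC uC' by blast
  have "a1 \<notin> nbs E b2" "a1 \<notin> nbs E b3" "a2 \<notin> nbs E b1" "a2 \<notin> nbs E b3" "a3 \<notin> nbs E b1" "a3 \<notin> nbs E b2"
    unfolding nbs_sym[of a1] nbs_sym[of a2] nbs_sym[of a3] using na b by auto
  then have au: "a1 \<notin> {u1, v1, u2, v2, u3, v3}" "a2 \<notin> {u1, v1, u2, v2, u3, v3}" "a3 \<notin> {u1, v1, u2, v2, u3, v3}"
    using nb1(1-3) nb2(1-3) nb3(1-3) by auto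
  have au: "\<forall>x\<in>{a1, a2, a3}. \<forall>y\<in>{u1, v1, u2, v2, u3, v3}. x \<noteq> y \<and> y \<noteq> x"
    using au by blast
  note ne = side[simplified] au[simplified] nr(2-4) nr(2-4)[symmetric] na(4-6) na(4-6)[symmetric] b b[symmetric]
    nb1(4) nb1(4)[symmetric] nb2(4) nb2(4)[symmetric] nb3(4) nb3(4)[symmetric] nb1(7) nb1(7)[symmetric]
  let ?S = "{{r, a1}, {r, a2}, {r, a3}, {a1, b1}, {a2, b2}, {a3, b3}}"
  let ?F1 = "{{b1, u1}, {b1, v1}}" and ?F2 = "{{b2, u2}, {b2, v2}}" and ?F3 = "{{b3, u3}, {b3, v3}}"
  let ?G1 = "{{u1, u1'}, {v1, v1'}}" and ?G2 = "{{u2, u2'}, {v2, v2'}}" and ?G3 = "{{u3, u3'}, {v3, v3'}}"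
  have dist: "distinct [{r, a1}, {r, a2}, {r, a3}, {a1, b1}, {a2, b2}, {a3, b3}]"
    by (simp add: doubleton_eq_iff ne)
  have Nr: "{f. near E {r, a1} f} \<subseteq> ?S \<union> ?F1" "{f. near E {r, a2} f} \<subseteq> ?S \<union> ?F2" "{f. near E {r, a3} f} \<subseteq> ?S \<union> ?F3"
    by (rule subset_trans[OF near_stars[OF E1(1)]] subset_trans[OF near_stars[OF E1(2)]]
        subset_trans[OF near_stars[OF E1(3)]],
      simp add: nr(1) na(1-3) nb1(1) nb2(1) nb3(1) insert_Diff_if ne doubleton_eq_iff)+
  have Nt: "{f. near E {a1, b1} f} \<subseteq> ?S \<union> ?F1 \<union> ?G1" "{f. near E {a2, b2} f} \<subseteq> ?S \<union> ?F2 \<union> ?G2"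
    "{f. near E {a3, b3} f} \<subseteq> ?S \<union> ?F3 \<union> ?G3"
    by (rule subset_trans[OF near_stars[OF E1(4)]] subset_trans[OF near_stars[OF E1(5)]]
        subset_trans[OF near_stars[OF E1(6)]],
      simp add: nr(1) na(1-3) nb1(1,5,6) nb2(1,5,6) nb3(1,5,6) insert_Diff_if ne doubleton_eq_iff)+
  have FE: "?F1 \<subseteq> E - ?S" "?F2 \<subseteq> E - ?S" "?F3 \<subseteq> E - ?S"
    using E2 by (simp_all add: doubleton_eq_iff ne)
  have GE: "{u1, u1'} \<in> E - ?S"
    using E2(7) by (simp add: doubleton_eq_iff ne)
  have two: "card {a, b} \<le> 2" for a b :: "'a set"
    by (simp add: card_insert_if)
  \<comment> \<open>Distinctness of \<open>b1\<close>, \<open>b2\<close>, \<open>b3\<close> enters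
    here: a neighbor of \<open>r\<close> in this configuration is adjacent to only one of them, so
    no edge joins two of the outer edges.\<close>
  have apart: "\<not> near E {a, b} {a', b'}"
    if "nbs E a = {r, b}" "nbs E a' = {r, b'}" "a \<noteq> a'" "b \<noteq> b'" "a' \<noteq> r" "b' \<noteq> r"
      "b \<noteq> r" "b \<noteq> a'" "b' \<notin> nbs E b" for a b a' b'
  proof
    assume "near E {a, b} {a', b'}"
    then have "a' \<in> nbs E a \<or> b' \<in> nbs E a \<or> a' \<in> nbs E b \<or> b' \<in> nbs E b"
      unfolding near_def nbs_def by auto
    moreover have "a' \<notin> nbs E b" unfolding nbs_sym[of a'] that(2) using that(4,7) by simp
    ultimately show False using that(3-6,8,9) unfolding that(1) by simp
  qed
  have t: "\<not> near E {a1, b1} {a2, b2}" "\<not> near E {a1, b1} {a3, b3}" "\<not> near E {a2, b2} {a3, b3}"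
    by (rule apart; use na(1-3) nb1(1) nb2(1) in \<open>simp add: ne\<close>)+
  have fin: "?thesis" if "proper6 (near E) (E - ?S) c" "\<not> (c ` ?F1 = c ` ?F2 \<and> c ` ?F2 = c ` ?F3)" for c
    by (rule proper6_extend_star[OF near_symp near_irreflp refl dist that(1) Nr Nt _ _ _ _ _ _ two two two two two two FE t that(2)])
      simp_all
  have "\<exists>c. proper6 (near E) (E - ?S) c"
  proof (rule greedy_outside)
    show "?S \<subseteq> E" using E1 by simp
    show "\<exists>f\<in>?S. f \<noteq> e \<and> e \<inter> f \<noteq> {}" if "e \<in> ?S" for e
      using that by (elim insertE emptyE) (simp_all add: doubleton_eq_iff ne)
  qed simp
  then obtain c where c: "proper6 (near E) (E - ?S) c" by blast
  show ?thesis
  proof (cases "c ` ?F1 = c ` ?F2 \<and> c ` ?F2 = c ` ?F3")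
    case True
    have adj: "near E {b1, u1} {b1, v1}" "near E {b1, u1} {u1, u1'}" "near E {b1, v1} {u1, u1'}"
      "near E {b1, u1} {a1, b1}" "near E {b1, u1} {r, a1}" "near E {b1, v1} {a1, b1}" "near E {b1, v1} {r, a1}"
      "near E {u1, u1'} {a1, b1}"
      using E1 E2 by (auto intro: near_touch near_touch2[of _ "{b1, u1}"] near_touch2[of _ "{a1, b1}"]
        simp: doubleton_eq_iff ne)
    have FE1: "{b1, u1} \<in> E - ?S" "{b1, v1} \<in> E - ?S"
      using E2 by (simp_all add: doubleton_eq_iff ne)
    obtain c' where c': "proper6 (near E) (E - ?S) c'"
      "\<And>e. e \<notin> {{b1, u1}, {b1, v1}, {u1, u1'}} \<Longrightarrow> c' e = c e"
      "{c' {b1, u1}, c' {b1, v1}} \<noteq> {c {b1, u1}, c {b1, v1}}"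
      by (rule recolor_pair[OF near_symp near_irreflp c near_deg FE1 GE _ _ E1(4) E1(1) _ adj])
        (simp_all add: doubleton_eq_iff ne)
    \<comment> \<open>The third edge that may be recolored could a priori lie in \<open>?F2\<close>.
      All colors of \<open>?F2\<close> occur on \<open>?F1\<close>, and \<open>{u1, u1'}\<close> has
      none of these, so \<open>?F2\<close> is unaffected.\<close>
    have "c {u1, u1'} \<notin> c ` ?F1"
      using proper6_neq[OF c adj(2)] proper6_neq[OF c adj(3)] FE(1) GE by simp
    then have "{b2, u2} \<noteq> {u1, u1'}" "{b2, v2} \<noteq> {u1, u1'}" using True by auto
    then have "c' {b2, u2} = c {b2, u2}" "c' {b2, v2} = c {b2, v2}"
      by (intro c'(2); simp add: doubleton_eq_iff ne)+
    then have "c' ` ?F2 = c ` ?F1" using True by simp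
    then have "c' ` ?F1 \<noteq> c' ` ?F2" using c'(3) by simp
    then show ?thesis by (intro fin[OF c'(1)] notI) (elim conjE notE)
  next
    case False
    show ?thesis by (rule fin[OF c False])
  qed
qed

lemma colorable: "\<exists>c. proper6 (near E) E c"
proof -
  consider "E = {}" | w where "degree E w = 1" | u v where "\<forall>w. degree E w \<noteq> 1" "{u, v} \<in> E" "degree E u = 2" "degree E v = 2"
    | "E \<noteq> {}" "\<forall>w. degree E w \<noteq> 1" "\<forall>u v. {u, v} \<in> E \<longrightarrow> \<not> (degree E u = 2 \<and> degree E v = 2)"
    by blast
  then show ?thesis
  proof cases
    case 1
    then show ?thesis unfolding proper6_def by simp
  next
    case 2
    then obtain x where "nbs E w = {x}" unfolding degree_nbs by (auto simp: card_1_singleton_iff)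
    then have "{w, x} \<in> E" unfolding nbs_def by blast
    then show ?thesis using colorable_if_pendant 2 by blast
  next
    case 3
    show ?thesis by (rule colorable_if_adjacent_degree_2[OF _ 3(2-4)]) (use 3(1) in blast)
  next
    case 4
    have all32: "degree E u = 2 \<and> degree E v = 3 \<or> degree E u = 3 \<and> degree E v = 2" if "{u, v} \<in> E" for u v
    proof -
      have "degree E u \<noteq> 1" "degree E v \<noteq> 1" "\<not> (degree E u = 2 \<and> degree E v = 2)"
        using 4(2,3) that by blast+
      then show ?thesis
        using degree_pos[OF that] deg3[of u] deg3[of v] deg5[OF that] by linarith
    qed
    obtain r x where r: "{r, x} \<in> E" "degree E r = 3"
    proof -
      obtain e where e: "e \<in> E" using 4(1) by blast
      obtain u v where uv: "{u, v} \<in> E" using edgeE[OF e] e by blast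
      then have vu: "{v, u} \<in> E" by (simp add: insert_commute)
      from all32[OF uv] show thesis using that[OF uv] that[OF vu] by blast
    qed
    obtain y z where nr: "nbs E r = {x, y, z}" "y \<noteq> x" "z \<noteq> x" "y \<noteq> z" using nbs_3[OF r] .
    obtain bx where bx: "nbs E x = {r, bx}" "bx \<noteq> r" using nbs_of_nbr[of x r] nr r(2) 4(2) by blast
    obtain b2 where b2: "nbs E y = {r, b2}" "b2 \<noteq> r" using nbs_of_nbr[of y r] nr r(2) 4(2) by blast
    obtain bz where bz: "nbs E z = {r, bz}" "bz \<noteq> r" using nbs_of_nbr[of z r] nr r(2) 4(2) by blast
    \<comment> \<open>A 4-cycle through \<open>r\<close> exists exactly when two of the second
      neighbors coincide; the first three cases differ only in the roles of \<open>x\<close>,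
      \<open>y\<close>, \<open>z\<close>.\<close>
    consider "bx = b2" | "bx = bz" | "b2 = bz" | "bx \<noteq> b2" "bx \<noteq> bz" "b2 \<noteq> bz" by blast
    then show ?thesis
    proof cases
      case 1
      show ?thesis by (rule colorable_if_square[OF all32, of r x y z bx]) (use nr bx b2 1 in auto)
    next
      case 2
      show ?thesis by (rule colorable_if_square[OF all32, of r x z y bx]) (use nr bx bz 2 in auto)
    next
      case 3
      show ?thesis by (rule colorable_if_square[OF all32, of r y z x b2]) (use nr b2 bz 3 in auto)
    next
      case 4
      show ?thesis by (rule colorable_if_no_square[OF all32, of r x y z bx b2 bz]) (use nr bx b2 bz 4 in auto)
    qed
  qed
qed

end

section \<open>Passage to disconnected graphs and to the strong chromatic index\<close>

lemma sparse_bipartite_subset: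
  assumes "sparse_bipartite E A" "S \<subseteq> E"
  shows "sparse_bipartite S A"
proof -
  interpret sparse_bipartite E A by fact
  have d: "degree S v \<le> degree E v" for v
    unfolding degree_def using fin assms(2) by (intro card_mono) auto
  show ?thesis
  proof
    show "finite S" using fin assms(2) finite_subset by blast
    show "\<exists>u v. e = {u, v}" if "e \<in> S" for e using edgeE that assms(2) by blast
    show "u \<in> A \<longleftrightarrow> v \<notin> A" if "{u, v} \<in> S" for u v using side that assms(2) by blast
    show "degree S v \<le> 3" for v using d[of v] deg3[of v] by linarith
    show "degree S u + degree S v \<le> 5" if "{u, v} \<in> S" for u v
      using d[of u] d[of v] deg5[of u v] that assms(2) by fastforce
  qed
qed

text \<open>Strong induction on the number of edges: if some \<open>S\<close> touches nothing
  outside it, \<open>S\<close> and \<open>E - S\<close> are colored independently with the same six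
  colors.\<close>

lemma sparse_bipartite_colorable:
  assumes "sparse_bipartite E A"
  shows "\<exists>c. proper6 (near E) E c"
  using assms
proof (induction "card E" arbitrary: E rule: less_induct)
  case less
  interpret sparse_bipartite E A by fact
  show ?case
  proof (cases "\<forall>S. S \<subseteq> E \<longrightarrow> S \<noteq> {} \<longrightarrow> S \<noteq> E \<longrightarrow> (\<exists>e\<in>E - S. \<exists>f\<in>S. e \<inter> f \<noteq> {})")
    case True
    then interpret connected_sparse_bipartite E A by unfold_locales blast
    show ?thesis by (rule colorable)
  next
    case False
    then obtain S where S: "S \<subseteq> E" "S \<noteq> {}" "S \<noteq> E"
      and sep: "\<not> (\<exists>e\<in>E - S. \<exists>f\<in>S. e \<inter> f \<noteq> {})"
      unfolding not_all not_imp by (elim exE conjE)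
    have "card S < card E" "card (E - S) < card E"
      using S fin by (auto intro!: psubset_card_mono)
    then obtain c d where c: "proper6 (near S) S c" and d: "proper6 (near (E - S)) (E - S) d"
      using less.hyps[of S] less.hyps[of "E - S"] S(1)
        sparse_bipartite_subset[OF less.prems, of S] sparse_bipartite_subset[OF less.prems, of "E - S"]
      by blast
    \<comment> \<open>The edge \<open>{x, y}\<close> that makes \<open>e\<close> and
      \<open>f\<close> near touches both, so all three lie on the same side of the splitting and
      nearness survives inside that part.\<close>
    have near: "near S e f \<and> f \<in> S \<or> near (E - S) e f \<and> e \<notin> S \<and> f \<notin> S" if ef: "near E e f" for e f
    proof -
      obtain x y where xy: "e \<in> E" "f \<in> E" "e \<noteq> f" "x \<in> e" "y \<in> f" "{x, y} \<in> E"
        using ef unfolding near_def by blast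
      have mem: "g \<in> S \<longleftrightarrow> h \<in> S" if "g \<in> E" "h \<in> E" "z \<in> g" "z \<in> h" for g h z
        using sep that by blast
      have "e \<in> S \<longleftrightarrow> {x, y} \<in> S" "f \<in> S \<longleftrightarrow> {x, y} \<in> S"
        using mem[of e "{x, y}" x] mem[of f "{x, y}" y] xy by auto
      then show ?thesis using xy unfolding near_def by blast
    qed
    have "proper6 (near E) E (\<lambda>e. if e \<in> S then c e else d e)"
      unfolding proper6_def
    proof (intro conjI ballI impI)
      fix e assume "e \<in> E"
      then show "(if e \<in> S then c e else d e) < 6" using c d unfolding proper6_def by auto
    next
      fix e f assume "e \<in> E" "f \<in> E" "near E e f"
      from near[OF this(3)] show "(if e \<in> S then c e else d e) \<noteq> (if f \<in> S then c f else d f)"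
      proof
        assume n: "near S e f \<and> f \<in> S"
        then have "e \<in> S" unfolding near_def by blast
        then show ?thesis using proper6_neq[OF c, of e f] n by simp
      next
        assume n: "near (E - S) e f \<and> e \<notin> S \<and> f \<notin> S"
        then show ?thesis using proper6_neq[OF d, of e f] \<open>e \<in> E\<close> \<open>f \<in> E\<close> by simp
      qed
    qed
    then show ?thesis by blast
  qed
qed

theorem theorem7:
  fixes V :: "'a set" and E :: "'a set set"
  assumes "finite_simple_graph V E"
    and "bipartite V E"
    and "max_degree V E \<le> 3"
    and "\<And>u v. {u, v} \<in> E \<Longrightarrow> degree E u + degree E v \<le> 5"
  shows "strong_chromatic_index E \<le> 6"
proof -
  have V: "finite V" "\<And>e. e \<in> E \<Longrightarrow> e \<subseteq> V"
    using assms(1) unfolding finite_simple_graph_def by blast+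
  obtain A B where AB: "A \<inter> B = {}" "\<forall>e\<in>E. \<exists>a\<in>A. \<exists>b\<in>B. e = {a, b}"
    using assms(2) unfolding bipartite_def by (elim exE conjE)
  have "sparse_bipartite E A"
  proof
    show "finite E" using V by (intro finite_subset[of E "Pow V"]) auto
    show "\<exists>u v. e = {u, v}" if "e \<in> E" for e using bspec[OF AB(2) that] by blast
    show "u \<in> A \<longleftrightarrow> v \<notin> A" if "{u, v} \<in> E" for u v
      using AB(1) bspec[OF AB(2) that] by (auto simp: doubleton_eq_iff)
    \<comment> \<open>\<open>max_degree\<close> ranges over \<open>V\<close> only; a vertex outside
      \<open>V\<close> lies on no edge and has degree 0.\<close>
    show "degree E v \<le> 3" for v
    proof (cases "v \<in> V")
      case True
      then have "degree E v \<le> max_degree V E" unfolding max_degree_def using V(1) by (intro Max_ge) auto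
      then show ?thesis using assms(3) by linarith
    next
      case False
      then have "{e \<in> E. v \<in> e} = {}" using V(2) by blast
      then show ?thesis unfolding degree_def by (simp only: card.empty)
    qed
  qed (rule assms(4))
  then obtain c where c: "proper6 (near E) E c" using sparse_bipartite_colorable by blast
  have "strong_edge_coloring E c"
    unfolding strong_edge_coloring_iff_distance[OF assms(1)]
  proof (intro ballI impI)
    fix e f assume ef: "e \<in> E" "f \<in> E" "e \<noteq> f \<and> (e \<inter> f \<noteq> {} \<or> (\<exists>x\<in>e. \<exists>y\<in>f. {x, y} \<in> E))"
    interpret sparse_bipartite E A by fact
    have "near E e f" using ef near_touch unfolding near_def by blast
    then show "c e \<noteq> c f" using proper6_neq[OF c] ef by blast
  qed
  then have "strong_chromatic_index E \<le> card (c ` E)"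
    unfolding strong_chromatic_index_def by (intro Least_le) blast
  also have "\<dots> \<le> card {..<6::nat}"
    using c unfolding proper6_def by (intro card_mono) auto
  finally show ?thesis by simp
qed

end
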